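(* Let $R$ be an irreducible root system, let $c$ be a root length of $R$, and let $A_c=\prod_{\alpha\in R_c^+}\sin\frac{\alpha}{2}$. If $\lambda\in P^+$ is a dominant weight, then $\mathrm{trig}(P_\lambda)^W$ is an invariant subspace of the first-order differential operator $\nabla\log|A_c|$, i.e. $(\nabla\log|A_c|)(\phi)\in\mathrm{trig}(P_\lambda)^W$ for every $\phi\in\mathrm{trig}(P_\lambda)^W$.
   Context: Let $V$ be a finite-dimensional real vector space with a positive-definite inner product $(\cdot,\cdot)$, used to identify $V$ with $V^*$; $\nabla$ is the corresponding gradient. For a smooth function $f$, the vector field $\nabla f$ acts as a differential operator by $\phi\mapsto(\nabla f,\nabla\phi)$ (with $(\cdot,\cdot)$ extended complex-bilinearly). For nonzero $\alpha\in V^*$ put $\breve\alpha=2\alpha/(\alpha,\alpha)$ and $s_\alpha(\beta)=\beta-(\breve\alpha,\beta)\alpha$. A root system is a finite spanning subset $R\subset V^*$ with $0\notin R$, $s_\alpha(R)\subset R$ and $(\breve\alpha,\beta)\in\mathbb{Z}$ for all $\alpha,\beta\in R$ (it need not be reduced). $P=\{\lambda\in V^*:(\breve\alpha,\lambda)\in\mathbb{Z}\ \forall\alpha\in R\}$ is the weight lattice and $W$ is the Weyl group. Fix an open Weyl chamber $C$; $R^+$ is the set of roots having positive inner product with all elements of $C$, and $P^+=P\cap\overline{C}$ is the set of dominant weights. The partial order on $P$ is: $\mu\le\lambda$ iff $\lambda-\mu$ is a sum of positive roots with non-negative integer coefficients. A root length is a number $c=\|\alpha\|$ with $\alpha\in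 R$; $R_c^+=\{\alpha\in R^+:\|\alpha\|=c\}$. Elements of $V^*$ are viewed as linear functions on $V$. All functions are restricted to the fundamental alcove $A\subset V$ (the connected component of $V\setminus\bigcup_{\alpha\in R}\{u:\alpha(u)\in2\pi\mathbb{Z}\}$ contained in $C$ with the origin as a boundary point), on which $A_c$ does not vanish. For $W$-invariant $S\subset V^*$, $\mathrm{trig}(S)$ is the complex span of the functions $e^{i\lambda}$, $\lambda\in S$, with $W$ acting by $w\cdot e^{i\lambda}=e^{iw(\lambda)}$, and $\mathrm{trig}(S)^W$ is the subspace of invariants. For $\lambda\in P^+$, $P_\lambda=\bigcup_{w\in W}\{w(\mu):\mu\in P^+,\ \mu\le\lambda\}$. *)

theory Defs
  imports "HOL-Analysis.Analysis"
begin

text \<open>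
  The finite-dimensional inner product space \<open>V\<close> is a type of class
  \<open>euclidean_space\<close>, identified with its dual by the inner product: the
  linear function belonging to \<open>\<alpha>\<close> is \<open>\<lambda>u. \<alpha> \<bullet> u\<close>.
\<close>

definition coroot :: "'v::euclidean_space \<Rightarrow> 'v" where
  "coroot \<alpha> = (2 / (\<alpha> \<bullet> \<alpha>)) *\<^sub>R \<alpha>"

definition reflection :: "'v::euclidean_space \<Rightarrow> 'v \<Rightarrow> 'v" where
  "reflection \<alpha> \<beta> = \<beta> - (coroot \<alpha> \<bullet> \<beta>) *\<^sub>R \<alpha>"

definition root_system :: "'v::euclidean_space set \<Rightarrow> bool" where
  "root_system R \<longleftrightarrow> finite R \<and> span R = UNIV \<and> 0 \<notin> R \<and>
     (\<forall>\<alpha>\<in>R. reflection \<alpha> ` R \<subseteq> R) \<and>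
     (\<forall>\<alpha>\<in>R. \<forall>\<beta>\<in>R. coroot \<alpha> \<bullet> \<beta> \<in> \<int>)"

definition irreducible_root_system :: "'v::euclidean_space set \<Rightarrow> bool" where
  "irreducible_root_system R \<longleftrightarrow> root_system R \<and> R \<noteq> {} \<and>
     \<not> (\<exists>R1 R2. R1 \<noteq> {} \<and> R2 \<noteq> {} \<and> R = R1 \<union> R2 \<and> (\<forall>\<alpha>\<in>R1. \<forall>\<beta>\<in>R2. \<alpha> \<bullet> \<beta> = 0))"

text \<open>Reflections are involutions, so closure under products gives the generated group.\<close>

inductive_set weyl_group :: "'v::euclidean_space set \<Rightarrow> ('v \<Rightarrow> 'v) set"
  for R :: "'v set" where
  id: "id \<in> weyl_group R"
| reflection: "w \<in> weyl_group R \<Longrightarrow> \<alpha> \<in> R \<Longrightarrow> reflection \<alpha> \<circ> w \<in> weyl_group R"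

definition weight_lattice :: "'v::euclidean_space set \<Rightarrow> 'v set" where
  "weight_lattice R = {\<mu>. \<forall>\<alpha>\<in>R. coroot \<alpha> \<bullet> \<mu> \<in> \<int>}"

definition weyl_chamber :: "'v::euclidean_space set \<Rightarrow> 'v set \<Rightarrow> bool" where
  "weyl_chamber R C \<longleftrightarrow> C \<in> components (UNIV - (\<Union>\<alpha>\<in>R. {u. \<alpha> \<bullet> u = 0}))"

definition positive_roots :: "'v::euclidean_space set \<Rightarrow> 'v set \<Rightarrow> 'v set" where
  "positive_roots R C = {\<alpha>\<in>R. \<forall>u\<in>C. \<alpha> \<bullet> u > 0}"

definition dominant_weights :: "'v::euclidean_space set \<Rightarrow> 'v set \<Rightarrow> 'v set" where
  "dominant_weights R C = weight_lattice R \<inter> closure C"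

definition weight_le :: "'v::euclidean_space set \<Rightarrow> 'v set \<Rightarrow> 'v \<Rightarrow> 'v \<Rightarrow> bool" where
  "weight_le R C \<mu> \<nu> \<longleftrightarrow>
     (\<exists>n :: 'v \<Rightarrow> nat. \<nu> - \<mu> = (\<Sum>\<alpha>\<in>positive_roots R C. real (n \<alpha>) *\<^sub>R \<alpha>))"

definition weights_below :: "'v::euclidean_space set \<Rightarrow> 'v set \<Rightarrow> 'v \<Rightarrow> 'v set" where
  "weights_below R C \<nu> =
     (\<Union>w\<in>weyl_group R. w ` {\<mu> \<in> dominant_weights R C. weight_le R C \<mu> \<nu>})"

definition root_length :: "'v::euclidean_space set \<Rightarrow> real \<Rightarrow> bool" where
  "root_length R c \<longleftrightarrow> c \<in> norm ` R"

definition fundamental_alcove :: "'v::euclidean_space set \<Rightarrow> 'v set \<Rightarrow> 'v set \<Rightarrow> bool" where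
  "fundamental_alcove R C A \<longleftrightarrow>
     A \<in> components (UNIV - (\<Union>\<alpha>\<in>R. {u. \<exists>k::int. \<alpha> \<bullet> u = 2 * pi * of_int k})) \<and>
     A \<subseteq> C \<and> 0 \<in> frontier A"

definition sin_product :: "'v::euclidean_space set \<Rightarrow> 'v set \<Rightarrow> real \<Rightarrow> 'v \<Rightarrow> real" where
  "sin_product R C c u = (\<Prod>\<alpha> | \<alpha> \<in> positive_roots R C \<and> norm \<alpha> = c. sin ((\<alpha> \<bullet> u) / 2))"

text \<open>
  Functions on a domain \<open>A\<close> are elements of \<open>extensional A\<close>, i.e. they are
  written \<open>\<lambda>u\<in>A. f u\<close>.
\<close>

definition trig_exp :: "'v::euclidean_space \<Rightarrow> 'v \<Rightarrow> complex" where
  "trig_exp \<mu> u = exp (\<i> * of_real (\<mu> \<bullet> u))"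

definition trig :: "'v::euclidean_space set \<Rightarrow> 'v set \<Rightarrow> ('v \<Rightarrow> complex) set" where
  "trig A S = {f. \<exists>T a. finite T \<and> T \<subseteq> S \<and> f = (\<lambda>u\<in>A. \<Sum>\<mu>\<in>T. a \<mu> * trig_exp \<mu> u)}"

text \<open>
  The exponentials are linearly independent on a nonempty open set
  (\<open>trig_exp_independent\<close> below), so the coefficients of a trigonometric polynomial on
  such a set are unique, and \<open>trig_act A w\<close> is the linear map that sends the
  exponential of \<open>\<mu>\<close> to the exponential of \<open>w \<mu>\<close> (\<open>trig_act_sum\<close>, \<open>trig_act_exp\<close>).
\<close>

definition trig_coeff :: "'v::euclidean_space set \<Rightarrow> ('v \<Rightarrow> complex) \<Rightarrow> 'v \<Rightarrow> complex" where
  "trig_coeff A f = (THE a. finite {\<mu>. a \<mu> \<noteq> 0} \<and>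
     f = (\<lambda>u\<in>A. \<Sum>\<mu> | a \<mu> \<noteq> 0. a \<mu> * trig_exp \<mu> u))"

definition trig_act ::
  "'v::euclidean_space set \<Rightarrow> ('v \<Rightarrow> 'v) \<Rightarrow> ('v \<Rightarrow> complex) \<Rightarrow> 'v \<Rightarrow> complex" where
  "trig_act A w f =
     (\<lambda>u\<in>A. \<Sum>\<mu> | trig_coeff A f \<mu> \<noteq> 0. trig_coeff A f \<mu> * trig_exp (w \<mu>) u)"

definition trig_invariants ::
  "'v::euclidean_space set \<Rightarrow> 'v set \<Rightarrow> 'v set \<Rightarrow> ('v \<Rightarrow> complex) set" where
  "trig_invariants R A S = {f \<in> trig A S. \<forall>w\<in>weyl_group R. trig_act A w f = f}"

lemma has_derivative_trig_exp:
  "(trig_exp \<mu> has_derivative (\<lambda>h. \<i> * of_real (\<mu> \<bullet> h) * trig_exp \<mu> x)) (at x)"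
proof -
  have "((\<lambda>y. \<i> * of_real (\<mu> \<bullet> y) :: complex) has_derivative (\<lambda>h. \<i> * of_real (\<mu> \<bullet> h))) (at x)"
    by (intro has_derivative_mult_right has_derivative_of_real has_derivative_inner_right
        has_derivative_ident)
  from has_derivative_compose[OF this DERIV_exp[unfolded has_field_derivative_def]]
  show ?thesis by (simp add: trig_exp_def[abs_def] mult.commute)
qed

lemma trig_exp_independent:
  fixes A :: "'v::euclidean_space set"
  assumes "open A" "A \<noteq> {}" "finite T"
    and "\<And>u. u \<in> A \<Longrightarrow> (\<Sum>\<mu>\<in>T. a \<mu> * trig_exp \<mu> u) = 0"
    and "\<nu> \<in> T"
  shows "a \<nu> = 0"
  using assms(3-5)
proof (induction T arbitrary: a \<nu> rule: finite_induct)
  case empty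
  then show ?case by simp
next
  case (insert \<kappa> T)
  have zero: "a \<mu> = 0" if \<mu>: "\<mu> \<in> T" for \<mu>
  proof -
    define v where "v = \<mu> - \<kappa>"
    have "(\<Sum>\<rho>\<in>T. (a \<rho> * \<i> * of_real ((\<rho> - \<kappa>) \<bullet> v)) * trig_exp \<rho> u) = 0" if u: "u \<in> A" for u
    proof -
      have "((\<lambda>y. \<Sum>\<rho>\<in>insert \<kappa> T. a \<rho> * trig_exp \<rho> y) has_derivative
              (\<lambda>h. \<Sum>\<rho>\<in>insert \<kappa> T. a \<rho> * (\<i> * of_real (\<rho> \<bullet> h) * trig_exp \<rho> u))) (at u)"
        by (intro has_derivative_sum has_derivative_mult_right has_derivative_trig_exp)
      moreover have "((\<lambda>y. \<Sum>\<rho>\<in>insert \<kappa> T. a \<rho> * trig_exp \<rho> y) has_derivative (\<lambda>h. 0)) (at u)"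
        by (rule has_derivative_transform_within_open[OF has_derivative_const assms(1) u])
           (use insert.prems(1) in simp)
      ultimately have "(\<lambda>h. \<Sum>\<rho>\<in>insert \<kappa> T. a \<rho> * (\<i> * of_real (\<rho> \<bullet> h) * trig_exp \<rho> u)) = (\<lambda>h. 0)"
        by (rule has_derivative_unique)
      from fun_cong[OF this, of v]
      have d: "(\<Sum>\<rho>\<in>insert \<kappa> T. a \<rho> * (\<i> * of_real (\<rho> \<bullet> v) * trig_exp \<rho> u)) = 0" .
      have "(\<Sum>\<rho>\<in>insert \<kappa> T. (a \<rho> * \<i> * of_real ((\<rho> - \<kappa>) \<bullet> v)) * trig_exp \<rho> u) =
          (\<Sum>\<rho>\<in>insert \<kappa> T. a \<rho> * (\<i> * of_real (\<rho> \<bullet> v) * trig_exp \<rho> u))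
          - \<i> * of_real (\<kappa> \<bullet> v) * (\<Sum>\<rho>\<in>insert \<kappa> T. a \<rho> * trig_exp \<rho> u)"
        by (simp only: sum_distrib_left sum_subtractf[symmetric])
           (rule sum.cong, simp_all add: inner_diff_left algebra_simps)
      also have "\<dots> = 0" using d insert.prems(1)[OF u] by simp
      finally show ?thesis using insert.hyps by simp
    qed
    from insert.IH[OF this \<mu>] have "a \<mu> = 0 \<or> v \<bullet> v = 0"
      by (simp add: v_def)
    then show ?thesis using \<mu> insert.hyps by (auto simp: v_def)
  qed
  obtain u where u: "u \<in> A" using assms(2) by blast
  have "a \<kappa> = 0"
    using insert.prems(1)[OF u] insert.hyps zero by (simp add: trig_exp_def)
  then show ?case using zero insert.prems(2) by blast
qed

lemma trig_coeff_eq: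
  fixes A :: "'v::euclidean_space set"
  assumes A: "open A" "A \<noteq> {}" and fin: "finite {\<mu>. a \<mu> \<noteq> 0}"
  shows "trig_coeff A (\<lambda>u\<in>A. \<Sum>\<mu> | a \<mu> \<noteq> 0. a \<mu> * trig_exp \<mu> u) = a"
  unfolding trig_coeff_def
proof (rule the_equality)
  fix b assume b: "finite {\<mu>. b \<mu> \<noteq> 0} \<and>
    (\<lambda>u\<in>A. \<Sum>\<mu> | a \<mu> \<noteq> 0. a \<mu> * trig_exp \<mu> u) = (\<lambda>u\<in>A. \<Sum>\<mu> | b \<mu> \<noteq> 0. b \<mu> * trig_exp \<mu> u)"
  define T where "T = {\<mu>. a \<mu> \<noteq> 0} \<union> {\<mu>. b \<mu> \<noteq> 0}"
  have T: "finite T" using fin b by (simp add: T_def)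
  have "(\<Sum>\<mu>\<in>T. (b \<mu> - a \<mu>) * trig_exp \<mu> u) = 0" if u: "u \<in> A" for u
  proof -
    have "(\<Sum>\<mu>\<in>T. a \<mu> * trig_exp \<mu> u) = (\<Sum>\<mu> | a \<mu> \<noteq> 0. a \<mu> * trig_exp \<mu> u)"
      by (rule sum.mono_neutral_right) (use T in \<open>auto simp: T_def\<close>)
    moreover have "(\<Sum>\<mu>\<in>T. b \<mu> * trig_exp \<mu> u) = (\<Sum>\<mu> | b \<mu> \<noteq> 0. b \<mu> * trig_exp \<mu> u)"
      by (rule sum.mono_neutral_right) (use T in \<open>auto simp: T_def\<close>)
    moreover have "(\<Sum>\<mu> | a \<mu> \<noteq> 0. a \<mu> * trig_exp \<mu> u) = (\<Sum>\<mu> | b \<mu> \<noteq> 0. b \<mu> * trig_exp \<mu> u)"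
      using fun_cong[OF conjunct2[OF b], of u] u by simp
    ultimately show ?thesis by (simp add: left_diff_distrib sum_subtractf)
  qed
  then have "b \<mu> - a \<mu> = 0" if "\<mu> \<in> T" for \<mu>
    using trig_exp_independent[OF A T, of "\<lambda>\<mu>. b \<mu> - a \<mu>" \<mu>] that by blast
  then have "b \<mu> = a \<mu>" for \<mu>
    by (cases "\<mu> \<in> T") (auto simp: T_def)
  then show "b = a" by (rule ext)
qed (use fin in simp)

lemma trig_act_sum:
  fixes A :: "'v::euclidean_space set"
  assumes A: "open A" "A \<noteq> {}" and T: "finite T"
  shows "trig_act A w (\<lambda>u\<in>A. \<Sum>\<mu>\<in>T. a \<mu> * trig_exp \<mu> u) =
    (\<lambda>u\<in>A. \<Sum>\<mu>\<in>T. a \<mu> * trig_exp (w \<mu>) u)"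
proof -
  define b where "b \<mu> = (if \<mu> \<in> T then a \<mu> else 0)" for \<mu>
  have sub: "{\<mu>. b \<mu> \<noteq> 0} \<subseteq> T" by (auto simp: b_def)
  have eq: "(\<Sum>\<mu>\<in>T. a \<mu> * g \<mu>) = (\<Sum>\<mu> | b \<mu> \<noteq> 0. b \<mu> * g \<mu>)" for g :: "'v \<Rightarrow> complex"
    by (rule sum.mono_neutral_cong_right) (use T sub in \<open>auto simp: b_def\<close>)
  have "trig_coeff A (\<lambda>u\<in>A. \<Sum>\<mu>\<in>T. a \<mu> * trig_exp \<mu> u) = b"
    unfolding eq by (rule trig_coeff_eq[OF A finite_subset[OF sub T]])
  then show ?thesis by (simp add: trig_act_def eq)
qed

lemma trig_act_exp:
  fixes A :: "'v::euclidean_space set"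
  assumes "open A" "A \<noteq> {}"
  shows "trig_act A w (restrict (trig_exp \<mu>) A) = restrict (trig_exp (w \<mu>)) A"
  using trig_act_sum[OF assms, of "{\<mu>}" w "\<lambda>_. 1"] by simp

definition grad :: "('v::euclidean_space \<Rightarrow> real) \<Rightarrow> 'v \<Rightarrow> 'v" where
  "grad f u = (THE D. GDERIV f u :> D)"

text \<open>
  For complex-valued \<open>\<phi>\<close> the gradient is \<open>\<nabla>(Re \<phi>) + \<i> \<nabla>(Im \<phi>)\<close>; pairing it with the real
  vector \<open>\<nabla>f\<close> by the complex-bilinear extension of the inner product gives the two
  components below.
\<close>

definition grad_op ::
  "'v::euclidean_space set \<Rightarrow> ('v \<Rightarrow> real) \<Rightarrow> ('v \<Rightarrow> complex) \<Rightarrow> 'v \<Rightarrow> complex" where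
  "grad_op A f \<phi> = (\<lambda>u\<in>A. Complex (grad f u \<bullet> grad (\<lambda>x. Re (\<phi> x)) u)
                                 (grad f u \<bullet> grad (\<lambda>x. Im (\<phi> x)) u))"

lemma grad_eq:
  fixes f :: "'v::euclidean_space \<Rightarrow> real"
  assumes "GDERIV f u :> D"
  shows "grad f u = D"
  unfolding grad_def
proof (rule the_equality)
  fix E assume "GDERIV f u :> E"
  with assms have "(\<lambda>h. h \<bullet> E) = (\<lambda>h. h \<bullet> D)"
    unfolding gderiv_def by (rule has_derivative_unique[rotated])
  then show "E = D" by (metis inner_commute vector_eq_rdot)
qed (fact assms)

end

theory Submission
  imports Defs
begin

text \<open>
  Grouping the exponents of \<open>\<phi>\<close> by the reflection in \<open>\<alpha>\<close>, the derivative of \<open>\<phi>\<close> along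
  \<open>\<alpha>\<close> becomes a combination of differences \<open>exp (\<i> \<mu>) - exp (\<i> (\<mu> - m \<alpha>))\<close> with
  \<open>m = coroot \<alpha> \<bullet> \<mu>\<close>. The gradient of \<open>ln \<bar>sin (\<alpha> / 2)\<bar>\<close> multiplies it by
  \<open>cot (\<alpha> / 2) / 2\<close>, and the quotient is a geometric sum over the \<open>\<alpha>\<close>-string between \<open>\<mu>\<close>
  and its mirror image. These strings stay in \<open>weights_below R C \<nu>\<close> because that set consists of
  the weights all of whose Weyl images are \<open>\<le> \<nu>\<close>. Invariance holds because the Weyl group permutes
  the roots of length \<open>c\<close>.
\<close>

subsection \<open>Simple roots and dominant representatives\<close>

lemma linear_reflection: "linear (reflection \<alpha>)"
  unfolding reflection_def
  by (intro linearI) (simp_all add: algebra_simps inner_add_right)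

lemma coroot_self: "\<alpha> \<noteq> 0 \<Longrightarrow> coroot \<alpha> \<bullet> \<alpha> = 2"
  by (simp add: coroot_def)

lemma reflection_self: "\<alpha> \<noteq> 0 \<Longrightarrow> reflection \<alpha> \<alpha> = - \<alpha>"
  by (simp add: reflection_def coroot_self scaleR_2)

text \<open>Scaling cancels between the coroot and the root. Proportional roots, which a non-reduced
  system may contain, therefore share one reflection.\<close>

lemma reflection_scaleR_root: "c \<noteq> 0 \<Longrightarrow> reflection (c *\<^sub>R \<alpha>) = reflection \<alpha>"
  by (simp add: fun_eq_iff reflection_def coroot_def)

lemma reflection_minus_root: "reflection (- \<alpha>) = reflection \<alpha>"
  using reflection_scaleR_root[of "-1" \<alpha>] by simp

lemma reflection_reflection: "\<alpha> \<noteq> 0 \<Longrightarrow> reflection \<alpha> (reflection \<alpha> x) = x"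
  by (simp add: reflection_def inner_diff_right coroot_self algebra_simps scaleR_2)

lemma inner_reflection_swap: "reflection \<alpha> x \<bullet> y = x \<bullet> reflection \<alpha> y"
  by (simp add: reflection_def coroot_def inner_diff_left inner_diff_right inner_commute)

lemma inner_reflection_reflection: "\<alpha> \<noteq> 0 \<Longrightarrow> reflection \<alpha> x \<bullet> reflection \<alpha> y = x \<bullet> y"
  by (simp add: inner_reflection_swap reflection_reflection)

text \<open>Conjugating a reflection by an isometry reflects in the image vector; this form avoids
  an inverse of \<open>w\<close>.\<close>

lemma reflection_conj:
  assumes "linear w" "\<And>x y. w x \<bullet> w y = x \<bullet> y"
  shows "w (reflection \<beta> x) = reflection (w \<beta>) (w x)"
  using assms by (simp add: reflection_def coroot_def linear_diff linear_scale)

lemma coroot_inner_isometry: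
  assumes "linear w" "\<And>x y. w x \<bullet> w y = x \<bullet> y"
  shows "coroot (w \<alpha>) \<bullet> w x = coroot \<alpha> \<bullet> x"
  using assms by (simp add: coroot_def)

text \<open>A counterexample of least \<open>f\<close>-value would contradict the step. Below,
  \<open>f\<close> is the height \<open>\<alpha> \<bullet> base\<close> on the positive
  roots.\<close>

lemma finite_real_induct:
  fixes f :: "'a \<Rightarrow> real"
  assumes "finite S" "x \<in> S"
    and step: "\<And>x. x \<in> S \<Longrightarrow> (\<And>y. y \<in> S \<Longrightarrow> f y < f x \<Longrightarrow> P y) \<Longrightarrow> P x"
  shows "P x"
proof (rule ccontr)
  let ?B = "{y \<in> S. \<not> P y}"
  assume "\<not> P x"
  then have ne: "finite ?B" "?B \<noteq> {}" using assms by auto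
  from ex_min_if_finite[of "f ` ?B"] ne
  obtain y where "y \<in> ?B" "\<forall>z\<in>?B. \<not> f z < f y" by auto
  with step[of y] show False by auto
qed

section \<open>Positive roots and the closed chamber\<close>

locale chambered_root_system =
  fixes R C :: "'v::euclidean_space set"
  assumes root_system: "root_system R" and chamber: "weyl_chamber R C"
begin

abbreviation "R\<^sub>p \<equiv> positive_roots R C"
abbreviation "W \<equiv> weyl_group R"
abbreviation le (infix "\<preceq>" 50) where "le \<equiv> weight_le R C"

lemma finite_roots: "finite R"
  and root_nonzero: "\<alpha> \<in> R \<Longrightarrow> \<alpha> \<noteq> 0"
  and reflection_root: "\<alpha> \<in> R \<Longrightarrow> \<beta> \<in> R \<Longrightarrow> reflection \<alpha> \<beta> \<in> R"
  and coroot_root_Ints: "\<alpha> \<in> R \<Longrightarrow> \<beta> \<in> R \<Longrightarrow> coroot \<alpha> \<bullet> \<beta> \<in> \<int>"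
  using root_system by (auto simp: root_system_def)

lemma minus_root: "\<alpha> \<in> R \<Longrightarrow> - \<alpha> \<in> R"
  using reflection_root[of \<alpha> \<alpha>] by (simp add: reflection_self root_nonzero)

lemma pos_root: "\<alpha> \<in> R\<^sub>p \<Longrightarrow> \<alpha> \<in> R"
  by (simp add: positive_roots_def)

lemma finite_pos: "finite R\<^sub>p"
  using finite_roots by (simp add: positive_roots_def)

text \<open>Any point of the chamber would do: it decides the sign of every root, and pairing with
  it serves as the height in inductions.\<close>

definition base :: 'v where "base = (SOME u. u \<in> C)"

lemma base_in: "base \<in> C"
  using chamber in_components_nonempty unfolding base_def weyl_chamber_def some_in_eq by blast

lemma root_nonzero_on_chamber: "\<alpha> \<in> R \<Longrightarrow> u \<in> C \<Longrightarrow> \<alpha> \<bullet> u \<noteq> 0"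
  using chamber in_components_subset unfolding weyl_chamber_def by blast

text \<open>The chamber is connected and no root vanishes on it, so by the intermediate value
  theorem the sign at one point is the sign everywhere.\<close>

lemma pos_iff_base:
  assumes \<alpha>: "\<alpha> \<in> R"
  shows "\<alpha> \<in> R\<^sub>p \<longleftrightarrow> \<alpha> \<bullet> base > 0"
proof
  assume pos: "\<alpha> \<bullet> base > 0"
  have "\<alpha> \<bullet> u > 0" if u: "u \<in> C" for u
  proof (rule ccontr)
    assume "\<not> \<alpha> \<bullet> u > 0"
    moreover have "connected ((\<bullet>) \<alpha> ` C)"
      using chamber in_components_connected unfolding weyl_chamber_def
      by (intro connected_continuous_image continuous_intros) blast
    ultimately have "0 \<in> (\<bullet>) \<alpha> ` C"
      using connectedD_interval[of _ "\<alpha> \<bullet> u" "\<alpha> \<bullet> base" 0] u base_in pos by force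
    with root_nonzero_on_chamber[OF \<alpha>] show False by force
  qed
  then show "\<alpha> \<in> R\<^sub>p" using \<alpha> by (simp add: positive_roots_def)
qed (use base_in in \<open>simp add: positive_roots_def\<close>)

lemma neg_iff_base: "\<alpha> \<in> R \<Longrightarrow> - \<alpha> \<in> R\<^sub>p \<longleftrightarrow> \<alpha> \<bullet> base < 0"
  using pos_iff_base[of "- \<alpha>"] minus_root by simp

lemma root_cases: "\<alpha> \<in> R \<Longrightarrow> \<alpha> \<in> R\<^sub>p \<or> - \<alpha> \<in> R\<^sub>p"
  using root_nonzero_on_chamber[OF _ base_in, of \<alpha>] by (auto simp: pos_iff_base neg_iff_base)

lemma pos_base: "\<alpha> \<in> R\<^sub>p \<Longrightarrow> \<alpha> \<bullet> base > 0"
  using pos_iff_base pos_root by blast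

text \<open>The open cone \<open>D\<close> is convex, avoids all root hyperplanes and meets
  \<open>C\<close>, so it lies in the component \<open>C\<close>. A point of the closed cone is a
  limit of points of \<open>D\<close>, obtained by adding small multiples of
  \<open>base\<close>.\<close>

lemma closure_chamber: "closure C = {x. \<forall>\<alpha>\<in>R\<^sub>p. \<alpha> \<bullet> x \<ge> 0}"
proof
  have "closed {x. \<forall>\<alpha>\<in>R\<^sub>p. \<alpha> \<bullet> x \<ge> 0}"
    unfolding Ball_def
    by (intro closed_Collect_all closed_Collect_imp open_Collect_const closed_Collect_le
        continuous_intros)
  then show "closure C \<subseteq> {x. \<forall>\<alpha>\<in>R\<^sub>p. \<alpha> \<bullet> x \<ge> 0}"
    by (intro closure_minimal) (force simp: positive_roots_def)+
next
  define D where "D = {x. \<forall>\<alpha>\<in>R\<^sub>p. \<alpha> \<bullet> x > 0}"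
  have "convex (\<Inter>\<alpha>\<in>R\<^sub>p. {x. \<alpha> \<bullet> x > 0})"
    by (intro convex_INT convex_halfspace_gt)
  moreover have "(\<Inter>\<alpha>\<in>R\<^sub>p. {x. \<alpha> \<bullet> x > 0}) = D" by (auto simp: D_def)
  ultimately have conn: "connected D" using convex_connected by metis
  have sub: "D \<subseteq> UNIV - (\<Union>\<alpha>\<in>R. {u. \<alpha> \<bullet> u = 0})"
    using root_cases by (fastforce simp: D_def)
  have base: "base \<in> D" using pos_base by (simp add: D_def)
  have "D \<subseteq> C"
    using components_maximal[OF _ conn sub, of C] chamber base base_in
    unfolding weyl_chamber_def by blast
  show "{x. \<forall>\<alpha>\<in>R\<^sub>p. \<alpha> \<bullet> x \<ge> 0} \<subseteq> closure C"
  proof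
    fix x assume x: "x \<in> {x. \<forall>\<alpha>\<in>R\<^sub>p. \<alpha> \<bullet> x \<ge> 0}"
    have "x + (1 / real (Suc n)) *\<^sub>R base \<in> C" for n
    proof -
      have "0 < \<alpha> \<bullet> x + (1 / real (Suc n)) * (\<alpha> \<bullet> base)" if "\<alpha> \<in> R\<^sub>p" for \<alpha>
        using pos_base[OF that] x that by (intro add_nonneg_pos mult_pos_pos) auto
      then have "x + (1 / real (Suc n)) *\<^sub>R base \<in> D"
        by (simp add: D_def inner_add_right)
      with \<open>D \<subseteq> C\<close> show ?thesis by blast
    qed
    moreover have "(\<lambda>n. x + (1 / real (Suc n)) *\<^sub>R base) \<longlonglongrightarrow> x + 0 *\<^sub>R base"
      by (intro tendsto_intros LIMSEQ_Suc[OF lim_1_over_n])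
    ultimately show "x \<in> closure C"
      unfolding closure_sequential
      by (intro exI[of _ "\<lambda>n. x + (1 / real (Suc n)) *\<^sub>R base"]) simp
  qed
qed

text \<open>Both Cartan integers are positive. If both were at least 2, the squared norm of
  \<open>\<alpha> - \<beta>\<close> would be at most 0; so one of them is 1, and the corresponding
  reflection produces the difference up to sign.\<close>

lemma root_diff:
  assumes \<alpha>: "\<alpha> \<in> R" and \<beta>: "\<beta> \<in> R" and pos: "\<alpha> \<bullet> \<beta> > 0" and ne: "\<alpha> \<noteq> \<beta>"
  shows "\<beta> - \<alpha> \<in> R"
proof -
  obtain p q where p: "coroot \<alpha> \<bullet> \<beta> = of_int p" and q: "coroot \<beta> \<bullet> \<alpha> = of_int q"
    using coroot_root_Ints \<alpha> \<beta> by (metis Ints_cases)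
  have nz: "\<alpha> \<bullet> \<alpha> > 0" "\<beta> \<bullet> \<beta> > 0" using \<alpha> \<beta> root_nonzero by auto
  have pe: "real_of_int p * (\<alpha> \<bullet> \<alpha>) = 2 * (\<alpha> \<bullet> \<beta>)"
    using nz by (simp add: p[symmetric] coroot_def)
  have qe: "real_of_int q * (\<beta> \<bullet> \<beta>) = 2 * (\<alpha> \<bullet> \<beta>)"
    using nz by (simp add: q[symmetric] coroot_def inner_commute)
  have "real_of_int p * (\<alpha> \<bullet> \<alpha>) > 0" "real_of_int q * (\<beta> \<bullet> \<beta>) > 0" using pe qe pos by linarith+
  then have pq: "p \<ge> 1" "q \<ge> 1" using nz by (simp_all add: zero_less_mult_iff)
  have "p = 1 \<or> q = 1"
  proof (rule ccontr)
    assume "\<not> ?thesis"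
    with pq have "real_of_int p \<ge> 2" "real_of_int q \<ge> 2" by auto
    then have "2 * (\<alpha> \<bullet> \<alpha>) \<le> 2 * (\<alpha> \<bullet> \<beta>)" "2 * (\<beta> \<bullet> \<beta>) \<le> 2 * (\<alpha> \<bullet> \<beta>)"
      using nz pe qe mult_right_mono by (metis less_imp_le)+
    then have "(\<alpha> - \<beta>) \<bullet> (\<alpha> - \<beta>) \<le> 0"
      by (simp add: inner_diff_left inner_diff_right inner_commute)
    moreover have "(\<alpha> - \<beta>) \<bullet> (\<alpha> - \<beta>) > 0" using ne by simp
    ultimately show False by linarith
  qed
  then show ?thesis
  proof
    assume "p = 1"
    then show ?thesis using reflection_root[OF \<alpha> \<beta>] p by (simp add: reflection_def)
  next
    assume "q = 1"
    then have "\<alpha> - \<beta> \<in> R" using reflection_root[OF \<beta> \<alpha>] q by (simp add: reflection_def)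
    then show ?thesis using minus_root by fastforce
  qed
qed

text \<open>Simple roots are encoded as the indecomposable positive roots, which suits induction on
  the height. In a non-reduced system this excludes the double of a positive root.\<close>

definition simple :: "'v set" where
  "simple = {\<alpha> \<in> R\<^sub>p. \<forall>\<beta>\<in>R\<^sub>p. \<forall>\<gamma>\<in>R\<^sub>p. \<alpha> \<noteq> \<beta> + \<gamma>}"

lemma simple_pos: "\<alpha> \<in> simple \<Longrightarrow> \<alpha> \<in> R\<^sub>p"
  by (simp add: simple_def)

lemma simple_root: "\<alpha> \<in> simple \<Longrightarrow> \<alpha> \<in> R"
  using simple_pos pos_root by blast

text \<open>A positive root that is not simple splits into two positive roots of smaller
  height.\<close>

lemma pos_inner_nonneg:
  assumes "\<And>\<alpha>. \<alpha> \<in> simple \<Longrightarrow> \<alpha> \<bullet> x \<ge> 0" and "\<beta> \<in> R\<^sub>p"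
  shows "\<beta> \<bullet> x \<ge> 0"
proof (rule finite_real_induct[OF finite_pos \<open>\<beta> \<in> R\<^sub>p\<close>, where f = "\<lambda>\<alpha>. \<alpha> \<bullet> base"])
  fix \<beta> assume \<beta>: "\<beta> \<in> R\<^sub>p"
    and IH: "\<And>\<gamma>. \<gamma> \<in> R\<^sub>p \<Longrightarrow> \<gamma> \<bullet> base < \<beta> \<bullet> base \<Longrightarrow> \<gamma> \<bullet> x \<ge> 0"
  show "\<beta> \<bullet> x \<ge> 0"
  proof (cases "\<beta> \<in> simple")
    case False
    then obtain \<gamma> \<delta> where *: "\<gamma> \<in> R\<^sub>p" "\<delta> \<in> R\<^sub>p" "\<beta> = \<gamma> + \<delta>"
      using \<beta> by (auto simp: simple_def)
    then have "\<gamma> \<bullet> x \<ge> 0" "\<delta> \<bullet> x \<ge> 0"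
      using IH pos_base by (auto simp: inner_add_left)
    then show ?thesis by (simp add: * inner_add_left)
  qed (use assms in blast)
qed

text \<open>
  The second alternative is not just \<open>\<beta> = \<alpha>\<close> because \<open>R\<close> need not be reduced.
\<close>

lemma simple_reflection_pos:
  assumes \<alpha>: "\<alpha> \<in> simple" and "\<beta> \<in> R\<^sub>p"
  shows "reflection \<alpha> \<beta> \<in> R\<^sub>p \<or> (\<exists>c>0. \<beta> = c *\<^sub>R \<alpha>)"
proof (rule finite_real_induct[OF finite_pos \<open>\<beta> \<in> R\<^sub>p\<close>, where f = "\<lambda>\<alpha>. \<alpha> \<bullet> base"])
  fix \<beta> assume \<beta>: "\<beta> \<in> R\<^sub>p"
    and IH: "\<And>\<gamma>. \<gamma> \<in> R\<^sub>p \<Longrightarrow> \<gamma> \<bullet> base < \<beta> \<bullet> base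
               \<Longrightarrow> reflection \<alpha> \<gamma> \<in> R\<^sub>p \<or> (\<exists>c>0. \<gamma> = c *\<^sub>R \<alpha>)"
  note \<alpha>p = simple_pos[OF \<alpha>] note \<alpha>R = simple_root[OF \<alpha>]
  have indec: "\<gamma> \<in> R\<^sub>p \<Longrightarrow> \<delta> \<in> R\<^sub>p \<Longrightarrow> \<alpha> \<noteq> \<gamma> + \<delta>" for \<gamma> \<delta>
    using \<alpha> by (auto simp: simple_def)
  show "reflection \<alpha> \<beta> \<in> R\<^sub>p \<or> (\<exists>c>0. \<beta> = c *\<^sub>R \<alpha>)"
  proof (rule ccontr)
    assume neg: "\<not> ?thesis"
    have r: "reflection \<alpha> \<beta> \<in> R" using reflection_root \<alpha>R \<beta> pos_root by blast
    then have nr: "- reflection \<alpha> \<beta> \<in> R\<^sub>p" using neg root_cases by blast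
    have ne: "\<alpha> \<noteq> \<beta>" using neg by (metis scaleR_one zero_less_one)
    \<comment> \<open>Otherwise reflecting would add a non-negative multiple of
      \<open>\<alpha>\<close> and could not lower the height below 0.\<close>
    have ip: "\<alpha> \<bullet> \<beta> > 0"
    proof (rule ccontr)
      assume "\<not> \<alpha> \<bullet> \<beta> > 0"
      then have "(coroot \<alpha> \<bullet> \<beta>) * (\<alpha> \<bullet> base) \<le> 0"
        using pos_base[OF \<alpha>p] by (auto simp: coroot_def mult_le_0_iff divide_le_0_iff)
      moreover have "reflection \<alpha> \<beta> \<bullet> base < 0" using nr r neg_iff_base by blast
      ultimately show False using pos_base[OF \<beta>] by (simp add: reflection_def inner_diff_left)
    qed
    have d: "\<beta> - \<alpha> \<in> R" using root_diff[OF \<alpha>R pos_root[OF \<beta>] ip ne] .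
    \<comment> \<open>If instead \<open>\<alpha> - \<beta>\<close> were positive,
      \<open>\<alpha>\<close> would decompose as
      \<open>\<beta> + (\<alpha> - \<beta>)\<close>.\<close>
    have dp: "\<beta> - \<alpha> \<in> R\<^sub>p"
      using root_cases[OF d] indec[of \<beta> "\<alpha> - \<beta>"] \<beta> by auto
    have refl: "reflection \<alpha> (\<beta> - \<alpha>) = reflection \<alpha> \<beta> + \<alpha>"
      by (simp add: linear_diff[OF linear_reflection] reflection_self[OF root_nonzero[OF \<alpha>R]])
    from IH[OF dp] pos_base[OF \<alpha>p] consider "reflection \<alpha> (\<beta> - \<alpha>) \<in> R\<^sub>p"
      | c where "c > 0" "\<beta> - \<alpha> = c *\<^sub>R \<alpha>" by (auto simp: inner_diff_left)
    then show False
    proof cases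
      case 1
      \<comment> \<open>Here \<open>\<alpha>\<close> is the sum of the positive roots
        \<open>reflection \<alpha> (\<beta> - \<alpha>)\<close> and
        \<open>- reflection \<alpha> \<beta>\<close>.\<close>
      then show False using indec[OF 1 nr] refl by simp
    next
      case 2
      then have "\<beta> = (c + 1) *\<^sub>R \<alpha>" by (simp add: algebra_simps)
      with neg 2 show False by (metis add_pos_pos zero_less_one)
    qed
  qed
qed

text \<open>Reflecting \<open>\<beta>\<close> in a simple root of positive inner product with it
  lowers the height, and the reflection in \<open>\<beta>\<close> is the conjugate of the one in the
  lower root. If \<open>\<beta>\<close> is a multiple of the simple root, one letter
  suffices.\<close>

lemma reflection_as_word:
  assumes "\<beta> \<in> R\<^sub>p"
  shows "\<exists>l. set l \<subseteq> simple \<and> reflection \<beta> = foldr reflection l"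
proof (rule finite_real_induct[OF finite_pos assms, where f = "\<lambda>\<alpha>. \<alpha> \<bullet> base"])
  fix \<beta> assume \<beta>: "\<beta> \<in> R\<^sub>p"
    and IH: "\<And>\<gamma>. \<gamma> \<in> R\<^sub>p \<Longrightarrow> \<gamma> \<bullet> base < \<beta> \<bullet> base
               \<Longrightarrow> \<exists>l. set l \<subseteq> simple \<and> reflection \<gamma> = foldr reflection l"
  have "\<exists>\<alpha>\<in>simple. \<alpha> \<bullet> \<beta> > 0"
  proof (rule ccontr)
    assume "\<not> ?thesis"
    \<comment> \<open>\<open>pos_inner_nonneg\<close> is applied to the vector
      \<open>- \<beta>\<close>, on which every simple root would be non-negative.\<close>
    then have "\<beta> \<bullet> - \<beta> \<ge> 0" by (intro pos_inner_nonneg[OF _ \<beta>]) (auto simp: not_less)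
    then have "\<beta> = 0" using inner_gt_zero_iff[of \<beta>] by fastforce
    then show False using \<beta> pos_root root_nonzero by blast
  qed
  then obtain \<alpha> where \<alpha>: "\<alpha> \<in> simple" and ip: "\<alpha> \<bullet> \<beta> > 0" by blast
  have \<alpha>0: "\<alpha> \<noteq> 0" using \<alpha> simple_root root_nonzero by blast
  from simple_reflection_pos[OF \<alpha> \<beta>]
  show "\<exists>l. set l \<subseteq> simple \<and> reflection \<beta> = foldr reflection l"
  proof (elim disjE exE conjE)
    assume r: "reflection \<alpha> \<beta> \<in> R\<^sub>p"
    have "coroot \<alpha> \<bullet> \<beta> * (\<alpha> \<bullet> base) > 0"
      using ip \<alpha>0 by (intro mult_pos_pos pos_base[OF simple_pos[OF \<alpha>]]) (simp add: coroot_def)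
    then have "reflection \<alpha> \<beta> \<bullet> base < \<beta> \<bullet> base" by (simp add: reflection_def inner_diff_left)
    from IH[OF r this] obtain l
      where l: "set l \<subseteq> simple" "reflection (reflection \<alpha> \<beta>) = foldr reflection l" by blast
    have "reflection \<beta> x = reflection \<alpha> (reflection (reflection \<alpha> \<beta>) (reflection \<alpha> x))" for x
      using reflection_conj[OF linear_reflection inner_reflection_reflection[OF \<alpha>0], where \<beta> = "reflection \<alpha> \<beta>" and x = "reflection \<alpha> x"]
      by (simp add: reflection_reflection \<alpha>0)
    then have "reflection \<beta> = foldr reflection (\<alpha> # l @ [\<alpha>])"
      using l(2) by (simp add: fun_eq_iff)
    then show ?thesis using l(1) \<alpha> by (metis Un_subset_iff empty_subsetI insert_subset list.simps(15) set_append list.set(1))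
  next
    fix c assume "c > 0" "\<beta> = c *\<^sub>R \<alpha>"
    then show ?thesis using \<alpha>
      by (intro exI[of _ "[\<alpha>]"]) (auto simp: reflection_scaleR_root)
  qed
qed

text \<open>Each generator expands into simple letters, since a root and its negative give the same
  reflection.\<close>

lemma weyl_as_word:
  assumes "w \<in> W"
  shows "\<exists>l. set l \<subseteq> simple \<and> w = foldr reflection l"
  using assms
proof induction
  case id
  then show ?case by (intro exI[of _ "[]"]) (simp add: fun_eq_iff)
next
  case (reflection w \<beta>)
  then obtain l where l: "set l \<subseteq> simple" "w = foldr reflection l" by blast
  obtain l' where l': "set l' \<subseteq> simple" "reflection \<beta> = foldr reflection l'"
    using reflection_as_word root_cases[OF reflection.hyps(2)] by (metis reflection_minus_root)
  show ?case
    by (intro exI[of _ "l' @ l"]) (use l l' in \<open>auto simp: fun_eq_iff\<close>)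
qed

section \<open>The action of the Weyl group on roots and weights\<close>

lemma weyl_comp: "v \<in> W \<Longrightarrow> w \<in> W \<Longrightarrow> v \<circ> w \<in> W"
  by (induction rule: weyl_group.induct) (auto simp: comp_assoc intro: weyl_group.reflection)

lemma reflection_in_weyl: "\<alpha> \<in> R \<Longrightarrow> reflection \<alpha> \<in> W"
  using weyl_group.reflection[OF weyl_group.id] by fastforce

lemma weyl_linear: "w \<in> W \<Longrightarrow> linear w"
  by (induction rule: weyl_group.induct) (auto simp: linear_id[unfolded id_def] intro: linear_compose[unfolded o_def] linear_reflection)

lemma weyl_inner: "w \<in> W \<Longrightarrow> w x \<bullet> w y = x \<bullet> y"
  by (induction rule: weyl_group.induct) (auto simp: inner_reflection_reflection root_nonzero)

lemma weyl_root: "w \<in> W \<Longrightarrow> \<alpha> \<in> R \<Longrightarrow> w \<alpha> \<in> R"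
  by (induction rule: weyl_group.induct) (auto simp: reflection_root)

lemma weyl_weight: "w \<in> W \<Longrightarrow> \<mu> \<in> weight_lattice R \<Longrightarrow> w \<mu> \<in> weight_lattice R"
proof (induction rule: weyl_group.induct)
  case (reflection w \<alpha>)
  then show ?case
    by (auto simp: weight_lattice_def reflection_def inner_diff_right coroot_root_Ints
        intro!: Ints_diff Ints_mult)
qed simp

subsection \<open>Saturation of weights below a dominant weight\<close>

lemma le_refl: "\<mu> \<preceq> \<mu>"
  unfolding weight_le_def by (intro exI[of _ "\<lambda>_. 0"]) simp

lemma le_trans:
  assumes "\<kappa> \<preceq> \<mu>" "\<mu> \<preceq> \<nu>"
  shows "\<kappa> \<preceq> \<nu>"
proof -
  from assms obtain m n :: "'v \<Rightarrow> nat"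
    where "\<mu> - \<kappa> = (\<Sum>\<alpha>\<in>R\<^sub>p. real (m \<alpha>) *\<^sub>R \<alpha>)" "\<nu> - \<mu> = (\<Sum>\<alpha>\<in>R\<^sub>p. real (n \<alpha>) *\<^sub>R \<alpha>)"
    by (auto simp: weight_le_def)
  then have "\<nu> - \<kappa> = (\<Sum>\<alpha>\<in>R\<^sub>p. real (m \<alpha> + n \<alpha>) *\<^sub>R \<alpha>)"
    by (simp add: scaleR_add_left sum.distrib algebra_simps)
  then show ?thesis unfolding weight_le_def by (intro exI[of _ "\<lambda>\<alpha>. m \<alpha> + n \<alpha>"])
qed

lemma le_sub_pos_root:
  assumes "\<alpha> \<in> R\<^sub>p"
  shows "\<mu> - real n *\<^sub>R \<alpha> \<preceq> \<mu>"
proof -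
  have "(\<Sum>\<beta>\<in>R\<^sub>p. real (if \<beta> = \<alpha> then n else 0) *\<^sub>R \<beta>) = (\<Sum>\<beta>\<in>R\<^sub>p. if \<beta> = \<alpha> then real n *\<^sub>R \<beta> else 0)"
    by (rule sum.cong) auto
  also have "\<dots> = real n *\<^sub>R \<alpha>" using assms finite_pos by simp
  finally show ?thesis unfolding weight_le_def by (intro exI[of _ "\<lambda>\<beta>. if \<beta> = \<alpha> then n else 0"]) simp
qed

text \<open>An exchange property for the orbit of a dominant vector. The root \<open>\<beta>\<close>
  is moved through the word letter by letter while it stays positive; it must become proportional to
  some letter, because a positive root cannot be negative on \<open>x\<close> itself. That letter is
  then cancelled.\<close>

lemma exchange:
  assumes dom: "x \<in> closure C" and "set l \<subseteq> simple" and "\<beta> \<in> R\<^sub>p"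
    and "\<beta> \<bullet> foldr reflection l x < 0"
  shows "\<exists>l'. set l' \<subseteq> simple \<and> length l' < length l \<and>
           reflection \<beta> (foldr reflection l x) = foldr reflection l' x"
  using assms(2-)
proof (induction l arbitrary: \<beta>)
  case Nil
  then show ?case using dom by (force simp: closure_chamber)
next
  case (Cons \<alpha> l)
  define y where "y = foldr reflection l x"
  have \<alpha>: "\<alpha> \<in> simple" and \<alpha>0: "\<alpha> \<noteq> 0"
    using Cons.prems simple_root root_nonzero by auto
  from simple_reflection_pos[OF \<alpha> Cons.prems(2)]
  show ?case
  proof (elim disjE exE conjE)
    assume r: "reflection \<alpha> \<beta> \<in> R\<^sub>p"
    have "reflection \<alpha> \<beta> \<bullet> y < 0"
      using Cons.prems(3) by (simp add: y_def inner_reflection_swap)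
    with Cons.IH[OF _ r] Cons.prems(1) obtain l' where l': "set l' \<subseteq> simple" "length l' < length l"
        "reflection (reflection \<alpha> \<beta>) y = foldr reflection l' x"
      by (auto simp: y_def)
    have "reflection \<beta> (reflection \<alpha> y) = reflection \<alpha> (reflection (reflection \<alpha> \<beta>) y)"
      using reflection_conj[OF linear_reflection inner_reflection_reflection[OF \<alpha>0],
          where \<beta> = "reflection \<alpha> \<beta>" and x = y]
      by (simp add: reflection_reflection \<alpha>0)
    then show ?thesis using l' \<alpha>
      by (intro exI[of _ "\<alpha> # l'"]) (auto simp: y_def)
  next
    fix c assume "c > 0" "\<beta> = c *\<^sub>R \<alpha>"
    \<comment> \<open>Reflecting in \<open>\<beta>\<close> undoes the leading letter, so the tail
      \<open>l\<close> is the shorter word.\<close>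
    then show ?thesis using Cons.prems(1)
      by (intro exI[of _ l]) (auto simp: reflection_scaleR_root reflection_reflection \<alpha>0)
  qed
qed

lemma reflection_le:
  assumes "\<alpha> \<in> R\<^sub>p" "\<mu> \<in> weight_lattice R" "\<alpha> \<bullet> \<mu> \<ge> 0"
  shows "reflection \<alpha> \<mu> \<preceq> \<mu>"
proof -
  have "coroot \<alpha> \<bullet> \<mu> \<in> \<int>" using assms pos_root by (auto simp: weight_lattice_def)
  moreover have "coroot \<alpha> \<bullet> \<mu> \<ge> 0" using assms(3) by (simp add: coroot_def)
  ultimately obtain n where "coroot \<alpha> \<bullet> \<mu> = real n"
    by (metis Nats_altdef2 Nats_cases mem_Collect_eq)
  then show ?thesis using le_sub_pos_root[OF assms(1), of \<mu> n] by (simp add: reflection_def)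
qed

text \<open>Induction on the length of the word. If the leading letter pairs non-negatively with the
  rest, it only lowers the weight; otherwise \<open>exchange\<close> gives a shorter word for the
  same vector.\<close>

lemma word_le_dominant:
  assumes dom: "\<mu> \<in> dominant_weights R C" and "set l \<subseteq> simple"
  shows "foldr reflection l \<mu> \<preceq> \<mu>"
  using assms(2)
proof (induction "length l" arbitrary: l rule: less_induct)
  case less
  show ?case
  proof (cases l)
    case Nil
    then show ?thesis by (simp add: le_refl)
  next
    case (Cons \<alpha> k)
    define y where "y = foldr reflection k \<mu>"
    have \<alpha>: "\<alpha> \<in> R\<^sub>p" and k: "set k \<subseteq> simple" using less.prems Cons simple_pos by auto
    have y: "y \<preceq> \<mu>" using less.hyps[OF _ k] Cons by (simp add: y_def)
    have "foldr reflection k \<in> W" using k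
      by (induction k) (auto intro: weyl_group.intros simple_root simp flip: id_def)
    then have yw: "y \<in> weight_lattice R"
      using weyl_weight dom by (auto simp: y_def dominant_weights_def)
    show ?thesis
    proof (cases "\<alpha> \<bullet> y \<ge> 0")
      case True
      then have "reflection \<alpha> y \<preceq> y" using reflection_le[OF \<alpha> yw] by blast
      then show ?thesis using y le_trans by (simp add: Cons y_def)
    next
      case False
      then obtain l' where "set l' \<subseteq> simple" "length l' < length k"
          "reflection \<alpha> y = foldr reflection l' \<mu>"
        using exchange[OF _ k \<alpha>, of \<mu>] dom by (auto simp: y_def dominant_weights_def)
      then show ?thesis using less.hyps[of l'] by (simp add: Cons y_def)
    qed
  qed
qed

lemma weyl_le_dominant: "\<mu> \<in> dominant_weights R C \<Longrightarrow> w \<in> W \<Longrightarrow> w \<mu> \<preceq> \<mu>"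
  using weyl_as_word word_le_dominant by metis

text \<open>Reflecting in a simple root that is negative on \<open>x\<close> reduces the number of
  positive roots negative on \<open>x\<close>. The element \<open>w'\<close> records how to return,
  in place of a group inverse.\<close>

lemma dominant_representative:
  "\<exists>w\<in>W. \<exists>w'\<in>W. w x \<in> closure C \<and> w' (w x) = x"
proof (induction "card {\<beta>\<in>R\<^sub>p. \<beta> \<bullet> x < 0}" arbitrary: x rule: less_induct)
  case less
  show ?case
  proof (cases "\<forall>\<alpha>\<in>simple. \<alpha> \<bullet> x \<ge> 0")
    case True
    then have "x \<in> closure C" using pos_inner_nonneg by (auto simp: closure_chamber)
    then show ?thesis using weyl_group.id by (metis id_apply)
  next
    case False
    then obtain \<alpha> where \<alpha>: "\<alpha> \<in> simple" and neg: "\<alpha> \<bullet> x < 0" by force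
    note \<alpha>p = simple_pos[OF \<alpha>] note \<alpha>R = simple_root[OF \<alpha>] note \<alpha>0 = root_nonzero[OF \<alpha>R]
    let ?N = "\<lambda>x. {\<beta>\<in>R\<^sub>p. \<beta> \<bullet> x < 0}"
    have "reflection \<alpha> \<beta> \<in> ?N x - {\<alpha>}" if \<beta>: "\<beta> \<in> ?N (reflection \<alpha> x)" for \<beta>
    proof -
      have b: "\<beta> \<in> R\<^sub>p" "reflection \<alpha> \<beta> \<bullet> x < 0" using \<beta> by (auto simp: inner_reflection_swap)
      \<comment> \<open>For such a multiple the reflected root is
        \<open>- c *\<^sub>R \<alpha>\<close>, which is positive on \<open>x\<close>.\<close>
      have "\<beta> \<noteq> c *\<^sub>R \<alpha>" if "c > 0" for c
        using b(2) that neg mult_pos_neg[OF that neg]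
        by (auto simp: linear_scale[OF linear_reflection] reflection_self \<alpha>0)
      then have r: "reflection \<alpha> \<beta> \<in> R\<^sub>p" using simple_reflection_pos[OF \<alpha> b(1)] by blast
      \<comment> \<open>Missing \<open>\<alpha>\<close> makes the count drop strictly, as
        \<open>\<alpha>\<close> itself is negative on \<open>x\<close>.\<close>
      have "reflection \<alpha> \<beta> \<noteq> \<alpha>"
      proof
        assume "reflection \<alpha> \<beta> = \<alpha>"
        then have "\<beta> = - \<alpha>" by (metis reflection_reflection reflection_self \<alpha>0)
        then show False using pos_base[OF b(1)] pos_base[OF \<alpha>p] by simp
      qed
      with r b show ?thesis by simp
    qed
    then have sub: "reflection \<alpha> ` ?N (reflection \<alpha> x) \<subseteq> ?N x - {\<alpha>}" by (rule image_subsetI)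
    have "inj_on (reflection \<alpha>) (?N (reflection \<alpha> x))"
      by (rule inj_on_inverseI[of _ "reflection \<alpha>"]) (simp add: reflection_reflection \<alpha>0)
    then have "card (?N (reflection \<alpha> x)) \<le> card (?N x - {\<alpha>})"
      using sub finite_pos by (intro card_inj_on_le) auto
    also have "\<dots> < card (?N x)"
      using finite_pos \<alpha>p neg by (intro card_Diff1_less) auto
    finally obtain w w' where w: "w \<in> W" "w' \<in> W" "w (reflection \<alpha> x) \<in> closure C"
        "w' (w (reflection \<alpha> x)) = reflection \<alpha> x"
      using less.hyps by blast
    have "w \<circ> reflection \<alpha> \<in> W" "reflection \<alpha> \<circ> w' \<in> W"
      using w weyl_comp reflection_in_weyl[OF \<alpha>R] by auto
    moreover have "(reflection \<alpha> \<circ> w') ((w \<circ> reflection \<alpha>) x) = x"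
      using w by (simp add: reflection_reflection \<alpha>0)
    ultimately show ?thesis using w(3) by (metis comp_apply)
  qed
qed

text \<open>All images of a weight in the orbit of a dominant \<open>\<kappa>\<close> lie below
  \<open>\<kappa>\<close>, hence below \<open>\<nu>\<close>. Conversely, one of the images is
  dominant. This form makes membership checkable without finding that dominant image.\<close>

lemma mem_weights_below_iff:
  "\<mu> \<in> weights_below R C \<nu> \<longleftrightarrow> \<mu> \<in> weight_lattice R \<and> (\<forall>w\<in>W. w \<mu> \<preceq> \<nu>)"
proof (intro iffI conjI ballI; (elim conjE)?)
  assume "\<mu> \<in> weights_below R C \<nu>"
  then obtain v \<kappa> where *: "v \<in> W" "\<kappa> \<in> dominant_weights R C" "\<kappa> \<preceq> \<nu>" "\<mu> = v \<kappa>"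
    by (auto simp: weights_below_def)
  then show "\<mu> \<in> weight_lattice R" using weyl_weight by (auto simp: dominant_weights_def)
  fix w assume "w \<in> W"
  then have "(w \<circ> v) \<kappa> \<preceq> \<kappa>" using * weyl_comp weyl_le_dominant by blast
  then show "w \<mu> \<preceq> \<nu>" using * le_trans by simp
next
  assume \<mu>: "\<mu> \<in> weight_lattice R" "\<forall>w\<in>W. w \<mu> \<preceq> \<nu>"
  obtain w w' where w: "w \<in> W" "w' \<in> W" "w \<mu> \<in> closure C" "w' (w \<mu>) = \<mu>"
    using dominant_representative by blast
  then have "w \<mu> \<in> dominant_weights R C" using \<mu> weyl_weight by (simp add: dominant_weights_def)
  then have "w \<mu> \<in> {\<kappa> \<in> dominant_weights R C. \<kappa> \<preceq> \<nu>}" using \<mu> w by simp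
  then have "w' (w \<mu>) \<in> weights_below R C \<nu>"
    unfolding weights_below_def using w by blast
  then show "\<mu> \<in> weights_below R C \<nu>" by (simp add: w)
qed

text \<open>By \<open>mem_weights_below_iff\<close> each Weyl image of the string point has to lie
  below \<open>\<nu>\<close>. The string is counted from whichever end makes the image arise by
  subtracting positive roots.\<close>

lemma weights_below_saturated:
  assumes \<mu>: "\<mu> \<in> weights_below R C \<nu>" and \<alpha>: "\<alpha> \<in> R"
    and n: "real n \<le> coroot \<alpha> \<bullet> \<mu>"
  shows "\<mu> - real n *\<^sub>R \<alpha> \<in> weights_below R C \<nu>"
proof -
  have \<mu>P: "\<mu> \<in> weight_lattice R" and below: "\<And>w. w \<in> W \<Longrightarrow> w \<mu> \<preceq> \<nu>"
    using \<mu> by (auto simp: mem_weights_below_iff)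
  have "coroot \<alpha> \<bullet> \<mu> \<in> \<int>" using \<mu>P \<alpha> by (auto simp: weight_lattice_def)
  then obtain m where m: "coroot \<alpha> \<bullet> \<mu> = real m"
    using n by (metis Nats_altdef2 Nats_cases mem_Collect_eq of_nat_0_le_iff order_trans)
  have "\<mu> - real n *\<^sub>R \<alpha> \<in> weight_lattice R"
    using \<mu>P \<alpha> by (auto simp: weight_lattice_def inner_diff_right coroot_root_Ints intro!: Ints_diff Ints_mult)
  moreover have "w (\<mu> - real n *\<^sub>R \<alpha>) \<preceq> \<nu>" if w: "w \<in> W" for w
  proof (cases "w \<alpha> \<in> R\<^sub>p")
    case True
    have "w (\<mu> - real n *\<^sub>R \<alpha>) = w \<mu> - real n *\<^sub>R w \<alpha>"
      using weyl_linear[OF w] by (simp add: linear_diff linear_scale)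
    then show ?thesis using le_sub_pos_root[OF True] below[OF w] le_trans by metis
  next
    case False
    then have neg: "- w \<alpha> \<in> R\<^sub>p" using root_cases weyl_root[OF w \<alpha>] by blast
    \<comment> \<open>The same point counted from the far end of the string; \<open>w\<close> turns
      the added multiple of \<open>\<alpha>\<close> into a subtracted multiple of the positive root
      \<open>- w \<alpha>\<close>.\<close>
    have "\<mu> - real n *\<^sub>R \<alpha> = reflection \<alpha> \<mu> + real (m - n) *\<^sub>R \<alpha>"
      using n m by (simp add: reflection_def of_nat_diff algebra_simps)
    then have "w (\<mu> - real n *\<^sub>R \<alpha>) = (w \<circ> reflection \<alpha>) \<mu> - real (m - n) *\<^sub>R (- w \<alpha>)"
      using weyl_linear[OF w] by (simp add: linear_add linear_scale)
    moreover have "(w \<circ> reflection \<alpha>) \<mu> \<preceq> \<nu>"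
      using below weyl_comp[OF w reflection_in_weyl[OF \<alpha>]] by blast
    ultimately show ?thesis using le_sub_pos_root[OF neg] le_trans by metis
  qed
  ultimately show ?thesis by (simp add: mem_weights_below_iff)
qed

end

subsection \<open>Logarithmic gradient of the sine product\<close>

text \<open>The derivative is a linear functional, represented by the vector of its values on the
  basis; that vector is the gradient.\<close>

lemma inner_grad:
  fixes f :: "'v::euclidean_space \<Rightarrow> real"
  assumes "(f has_derivative f') (at u)"
  shows "g \<bullet> grad f u = f' g"
proof -
  have lin: "linear f'" using assms has_derivative_linear by blast
  have rep: "f' h = h \<bullet> (\<Sum>b\<in>Basis. f' b *\<^sub>R b)" for h
  proof -
    have "f' h = f' (\<Sum>b\<in>Basis. (h \<bullet> b) *\<^sub>R b)" by (simp add: euclidean_representation)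
    also have "\<dots> = (\<Sum>b\<in>Basis. (h \<bullet> b) * f' b)" by (simp add: linear_sum[OF lin] linear_scale[OF lin])
    finally show ?thesis by (simp add: inner_sum_right mult.commute)
  qed
  then have "f' = (\<lambda>h. h \<bullet> (\<Sum>b\<in>Basis. f' b *\<^sub>R b))" by (rule ext)
  with assms have "GDERIV f u :> (\<Sum>b\<in>Basis. f' b *\<^sub>R b)" by (simp add: gderiv_def)
  from grad_eq[OF this] rep[of g] show ?thesis by (simp only:)
qed

text \<open>The left-hand side has the shape used in \<open>grad_op\<close>, which thereby becomes a
  directional derivative.\<close>

lemma complex_inner_grad:
  fixes F :: "'v::euclidean_space \<Rightarrow> complex"
  assumes "(F has_derivative F') (at u)"
  shows "Complex (g \<bullet> grad (\<lambda>x. Re (F x)) u) (g \<bullet> grad (\<lambda>x. Im (F x)) u) = F' g"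
proof -
  have "((\<lambda>x. Re (F x)) has_derivative (\<lambda>h. Re (F' h))) (at u)"
    "((\<lambda>x. Im (F x)) has_derivative (\<lambda>h. Im (F' h))) (at u)"
    using assms bounded_linear.has_derivative[OF bounded_linear_Re]
      bounded_linear.has_derivative[OF bounded_linear_Im] by blast+
  then show ?thesis by (simp add: inner_grad)
qed

text \<open>The factored derivative in the hypothesis makes \<open>L\<close> the logarithmic
  derivative. Squaring \<open>f\<close> avoids a case split on its sign.\<close>

lemma has_derivative_ln_abs:
  fixes f :: "'v::euclidean_space \<Rightarrow> real"
  assumes f: "(f has_derivative (\<lambda>h. f u * L h)) (at u)" and nz: "f u \<noteq> 0"
  shows "((\<lambda>x. ln \<bar>f x\<bar>) has_derivative L) (at u)"
proof -
  \<comment> \<open>At \<open>y = 0\<close> this holds through the default value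
    \<open>ln 0 = 0\<close>.\<close>
  have "ln \<bar>y\<bar> = ln (y\<^sup>2) / 2" for y :: real
    using ln_realpow[of "\<bar>y\<bar>" 2] by (cases "y = 0") simp_all
  then have eq: "(\<lambda>x. ln \<bar>f x\<bar>) = (\<lambda>x. ln ((f x)\<^sup>2) * (1/2))" by (simp only: times_divide_eq_right mult_1_right)
  have "((\<lambda>x. (f x)\<^sup>2) has_derivative (\<lambda>h. 2 * (f u * L h) * f u)) (at u)"
    using has_derivative_power[OF f, of 2] by (simp add: mult_ac)
  then have "((\<lambda>x. ln ((f x)\<^sup>2) * (1/2)) has_derivative
      (\<lambda>h. 2 * (f u * L h) * f u * inverse ((f u)\<^sup>2) * (1/2))) (at u)"
    using nz by (intro has_derivative_mult_left has_derivative_ln) auto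
  moreover have "(\<lambda>h. 2 * (f u * L h) * f u * inverse ((f u)\<^sup>2) * (1/2)) = L"
    using nz by (simp add: fun_eq_iff field_simps power2_eq_square)
  ultimately show ?thesis by (simp add: eq)
qed

text \<open>The product rule, with the product factored out as \<open>has_derivative_ln_abs\<close>
  requires; cosines become sines times cotangents.\<close>

lemma has_derivative_sin_prod:
  fixes u :: "'v::euclidean_space"
  assumes "finite Q" "\<And>\<alpha>. \<alpha> \<in> Q \<Longrightarrow> sin ((\<alpha> \<bullet> u) / 2) \<noteq> 0"
  shows "((\<lambda>x. \<Prod>\<alpha>\<in>Q. sin ((\<alpha> \<bullet> x) / 2)) has_derivative
    (\<lambda>h. (\<Prod>\<alpha>\<in>Q. sin ((\<alpha> \<bullet> u) / 2)) * (\<Sum>\<alpha>\<in>Q. cot ((\<alpha> \<bullet> u) / 2) / 2 * (\<alpha> \<bullet> h)))) (at u)"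
  using assms
proof (induction Q rule: finite_induct)
  case (insert \<alpha> Q)
  have "((\<lambda>x. sin ((\<alpha> \<bullet> x) / 2)) has_derivative
      (\<lambda>h. sin ((\<alpha> \<bullet> u) / 2) * (cot ((\<alpha> \<bullet> u) / 2) / 2 * (\<alpha> \<bullet> h)))) (at u)"
    using insert.prems[of \<alpha>]
    by (auto intro!: derivative_eq_intros simp: fun_eq_iff cot_def)
  from has_derivative_mult[OF this insert.IH] insert.prems
  have "((\<lambda>x. sin ((\<alpha> \<bullet> x) / 2) * (\<Prod>\<alpha>\<in>Q. sin ((\<alpha> \<bullet> x) / 2))) has_derivative
    (\<lambda>h. sin ((\<alpha> \<bullet> u) / 2) * ((\<Prod>\<alpha>\<in>Q. sin ((\<alpha> \<bullet> u) / 2)) * (\<Sum>\<alpha>\<in>Q. cot ((\<alpha> \<bullet> u) / 2) / 2 * (\<alpha> \<bullet> h)))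
        + sin ((\<alpha> \<bullet> u) / 2) * (cot ((\<alpha> \<bullet> u) / 2) / 2 * (\<alpha> \<bullet> h)) * (\<Prod>\<alpha>\<in>Q. sin ((\<alpha> \<bullet> u) / 2)))) (at u)"
    by simp
  then show ?case
    using insert.hyps by (simp add: algebra_simps)
qed simp

section \<open>The cotangent as a multiplier along root strings\<close>

lemma trig_exp_eq_cis: "trig_exp \<mu> u = cis (\<mu> \<bullet> u)"
  by (simp add: trig_exp_def cis_conv_exp)

lemma trig_exp_diff: "trig_exp (\<mu> - r *\<^sub>R \<alpha>) u = trig_exp \<mu> u * cis (- (r * (\<alpha> \<bullet> u)))"
  by (simp add: trig_exp_eq_cis inner_diff_left cis_mult)

text \<open>
  With \<open>z = cis (- x)\<close> one has \<open>cot (x / 2) = \<i> (1 + z) / (1 - z)\<close>.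
\<close>

lemma cot_times_one_minus_cis:
  assumes "sin (x / 2) \<noteq> 0"
  shows "of_real (cot (x / 2)) * (1 - cis (- (real m * x))) =
    \<i> * (\<Sum>j<m. cis (- (real j * x)) + cis (- (real (Suc j) * x)))"
proof -
  define z where "z = cis (- x)"
  have pow: "cis (- (real j * x)) = z ^ j" for j
    using Complex.DeMoivre[of "- x" j] by (simp add: z_def)
  have c: "cos x = 1 - 2 * (sin (x/2))\<^sup>2" and s: "sin x = 2 * sin (x/2) * cos (x/2)"
    using cos_double_sin[of "x/2"] sin_double[of "x/2"] by simp_all
  have cs: "cos (x/2) * cos (x/2) + sin (x/2) * sin (x/2) = 1"
    using sin_cos_squared_add[of "x/2"] by (simp add: power2_eq_square)
  \<comment> \<open>In half angles, the real and imaginary parts reduce to the Pythagorean identity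
    \<open>cs\<close>.\<close>
  have "of_real (cot (x / 2)) * (1 - z) = \<i> * (1 + z)"
    using assms by (simp add: complex_eq_iff z_def cot_def c s)
      (simp add: field_simps power2_eq_square, use cs in linarith)
  \<comment> \<open>\<open>1 - z ^ m\<close> is \<open>1 - z\<close> times a geometric sum, so no
    division by \<open>1 - z\<close> is needed.\<close>
  then have "of_real (cot (x / 2)) * (1 - z ^ m) = \<i> * (1 + z) * (\<Sum>j<m. z ^ j)"
    by (simp add: one_diff_power_eq)
  also have "\<dots> = \<i> * (\<Sum>j<m. z ^ j + z ^ Suc j)"
    by (simp add: sum.distrib sum_distrib_left algebra_simps)
  finally show ?thesis by (simp only: pow)
qed

text \<open>
  The sum runs over the \<open>\<alpha>\<close>-string from \<open>\<kappa>\<close> to \<open>reflection \<alpha> \<kappa>\<close>, where the end points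
  have weight 1 and the interior points weight 2; the sign makes it even in \<open>\<alpha>\<close>.
\<close>

definition string_sum ::
  "'v::euclidean_space \<Rightarrow> 'v \<Rightarrow> ('v \<Rightarrow> complex) \<Rightarrow> complex" where
  "string_sum \<alpha> \<kappa> E = (\<Sum>j<nat \<lfloor>\<bar>coroot \<alpha> \<bullet> \<kappa>\<bar>\<rfloor>.
     E (\<kappa> - (real j * sgn (\<alpha> \<bullet> \<kappa>)) *\<^sub>R \<alpha>) + E (\<kappa> - (real (Suc j) * sgn (\<alpha> \<bullet> \<kappa>)) *\<^sub>R \<alpha>))"

text \<open>The sum involves only inner products and linear combinations of its two vectors, so an
  isometry can be shifted onto the exponents. This is how a Weyl element is pulled out of a sum over
  roots and weights.\<close>

lemma string_sum_isometry:
  assumes w: "linear w" "\<And>x y. w x \<bullet> w y = x \<bullet> y"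
  shows "string_sum (w \<alpha>) (w \<kappa>) E = string_sum \<alpha> \<kappa> (\<lambda>\<kappa>. E (w \<kappa>))"
  using w by (simp add: string_sum_def coroot_inner_isometry linear_diff linear_scale)

text \<open>After the sign of \<open>\<alpha> \<bullet> \<kappa>\<close> is absorbed into the angle,
  the difference of exponentials is \<open>trig_exp \<kappa> u\<close> times
  \<open>1 - cis (- (real m * x))\<close>, to which \<open>cot_times_one_minus_cis\<close>
  applies.\<close>

lemma cot_string:
  fixes \<alpha> \<kappa> u :: "'v::euclidean_space"
  assumes sin: "sin ((\<alpha> \<bullet> u) / 2) \<noteq> 0" and int: "coroot \<alpha> \<bullet> \<kappa> \<in> \<int>"
  shows "of_real (cot ((\<alpha> \<bullet> u) / 2) * (\<alpha> \<bullet> \<kappa>)) * (trig_exp \<kappa> u - trig_exp (reflection \<alpha> \<kappa>) u) =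
    \<i> * of_real \<bar>\<alpha> \<bullet> \<kappa>\<bar> * string_sum \<alpha> \<kappa> (\<lambda>\<kappa>. trig_exp \<kappa> u)"
proof (cases "\<alpha> \<bullet> \<kappa> = 0")
  case False
  define s m where "s = sgn (\<alpha> \<bullet> \<kappa>)" and "m = nat \<lfloor>\<bar>coroot \<alpha> \<bullet> \<kappa>\<bar>\<rfloor>"
  have \<alpha>0: "\<alpha> \<noteq> 0" using False by auto
  have "sgn (coroot \<alpha> \<bullet> \<kappa>) = s" using \<alpha>0 by (simp add: coroot_def s_def sgn_mult)
  \<comment> \<open>Integrality makes the floor in \<open>m\<close> exact.\<close>
  moreover have "\<bar>coroot \<alpha> \<bullet> \<kappa>\<bar> = real m" using int by (auto simp: m_def elim!: Ints_cases)
  ultimately have cm: "coroot \<alpha> \<bullet> \<kappa> = real m * s" by (metis mult_sgn_abs mult.commute)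
  have s1: "s = 1 \<or> s = -1" using False by (auto simp: s_def sgn_if)
  \<comment> \<open>The cotangent is odd, so the sign moves from the inner product into its
    argument.\<close>
  then have sgn: "cot ((\<alpha> \<bullet> u) / 2) * (\<alpha> \<bullet> \<kappa>) = cot (s * (\<alpha> \<bullet> u) / 2) * \<bar>\<alpha> \<bullet> \<kappa>\<bar>"
    and sin': "sin (s * (\<alpha> \<bullet> u) / 2) \<noteq> 0"
    using False sin by (auto simp: s_def sgn_if cot_def split: if_splits)
  have refl: "reflection \<alpha> \<kappa> = \<kappa> - (real m * s) *\<^sub>R \<alpha>" by (simp add: reflection_def cm)
  define x where "x = s * (\<alpha> \<bullet> u)"
  have str: "string_sum \<alpha> \<kappa> (\<lambda>\<kappa>. trig_exp \<kappa> u) = trig_exp \<kappa> u *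
      (\<Sum>j<m. cis (- (real j * x)) + cis (- (real (Suc j) * x)))"
    by (simp only: string_sum_def trig_exp_diff sum_distrib_left distrib_left flip: s_def m_def)
       (simp only: mult.assoc x_def)
  have "\<i> * of_real \<bar>\<alpha> \<bullet> \<kappa>\<bar> * string_sum \<alpha> \<kappa> (\<lambda>\<kappa>. trig_exp \<kappa> u) =
      of_real \<bar>\<alpha> \<bullet> \<kappa>\<bar> * trig_exp \<kappa> u *
        (\<i> * (\<Sum>j<m. cis (- (real j * x)) + cis (- (real (Suc j) * x))))"
    unfolding str by (simp only: mult_ac)
  also have "\<dots> = of_real \<bar>\<alpha> \<bullet> \<kappa>\<bar> * trig_exp \<kappa> u *
        (of_real (cot (x / 2)) * (1 - cis (- (real m * x))))"
    using cot_times_one_minus_cis[OF sin'[folded x_def], of m] by (simp only:)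
  also have "\<dots> = of_real (cot ((\<alpha> \<bullet> u) / 2) * (\<alpha> \<bullet> \<kappa>)) *
      (trig_exp \<kappa> u - trig_exp (reflection \<alpha> \<kappa>) u)"
    unfolding sgn refl trig_exp_diff of_real_mult x_def by (simp add: algebra_simps)
  finally show ?thesis by (rule sym)
qed simp

subsection \<open>Invariant trigonometric polynomials\<close>

text \<open>
  A trigonometric polynomial together with all its transforms under linear maps of the
  exponents; this sidesteps the uniqueness of coefficients.
\<close>

definition trig_family ::
  "'v::euclidean_space set \<Rightarrow> (('v \<Rightarrow> 'v) \<Rightarrow> 'v \<Rightarrow> complex) \<Rightarrow> bool" where
  "trig_family S G \<longleftrightarrow> (\<exists>T a. finite T \<and> T \<subseteq> S \<and>
     G = (\<lambda>w u. \<Sum>\<mu>\<in>T. a \<mu> * trig_exp (w \<mu>) u))"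

lemma trig_family_exp: "\<mu> \<in> S \<Longrightarrow> trig_family S (\<lambda>w u. trig_exp (w \<mu>) u)"
  unfolding trig_family_def by (intro exI[of _ "{\<mu>}"] exI[of _ "\<lambda>_. 1"]) auto

lemma trig_family_cmult: "trig_family S G \<Longrightarrow> trig_family S (\<lambda>w u. c * G w u)"
  unfolding trig_family_def
proof (elim exE conjE, intro exI conjI)
  fix T a assume "G = (\<lambda>w u. \<Sum>\<mu>\<in>T. a \<mu> * trig_exp (w \<mu>) u)"
  then show "(\<lambda>w u. c * G w u) = (\<lambda>w u. \<Sum>\<mu>\<in>T. (c * a \<mu>) * trig_exp (w \<mu>) u)"
    by (simp add: sum_distrib_left mult.assoc)
qed

lemma trig_family_zero: "trig_family S (\<lambda>w u. 0)"
  unfolding trig_family_def by (intro exI[of _ "{}"]) auto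

lemma trig_family_add:
  assumes "trig_family S G" "trig_family S H"
  shows "trig_family S (\<lambda>w u. G w u + H w u)"
proof -
  from assms obtain T a U b
    where T: "finite T" "T \<subseteq> S" and G: "G = (\<lambda>w u. \<Sum>\<mu>\<in>T. a \<mu> * trig_exp (w \<mu>) u)"
      and U: "finite U" "U \<subseteq> S" and H: "H = (\<lambda>w u. \<Sum>\<mu>\<in>U. b \<mu> * trig_exp (w \<mu>) u)"
    unfolding trig_family_def by blast
  define c where "c \<mu> = (if \<mu> \<in> T then a \<mu> else 0) + (if \<mu> \<in> U then b \<mu> else 0)" for \<mu>
  have "(\<Sum>\<mu>\<in>T. a \<mu> * E \<mu>) + (\<Sum>\<mu>\<in>U. b \<mu> * E \<mu>) = (\<Sum>\<mu>\<in>T \<union> U. c \<mu> * E \<mu>)" for E :: "'a \<Rightarrow> complex"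
  proof -
    have "(\<Sum>\<mu>\<in>T. a \<mu> * E \<mu>) = (\<Sum>\<mu>\<in>T \<union> U. (if \<mu> \<in> T then a \<mu> else 0) * E \<mu>)"
      "(\<Sum>\<mu>\<in>U. b \<mu> * E \<mu>) = (\<Sum>\<mu>\<in>T \<union> U. (if \<mu> \<in> U then b \<mu> else 0) * E \<mu>)"
      using T U by (auto intro!: sum.mono_neutral_cong_left)
    then show ?thesis by (simp add: c_def distrib_right sum.distrib)
  qed
  then show ?thesis
    unfolding trig_family_def G H using T U by (intro exI[of _ "T \<union> U"] exI[of _ c]) auto
qed

lemma trig_family_sum:
  "(\<And>i. i \<in> I \<Longrightarrow> trig_family S (G i)) \<Longrightarrow> trig_family S (\<lambda>w u. \<Sum>i\<in>I. G i w u)"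
  by (induction I rule: infinite_finite_induct) (simp_all add: trig_family_zero trig_family_add)

text \<open>By \<open>trig_act_sum\<close>, acting on any expansion moves its exponents. Invariance
  thus means that the members of one family indexed by Weyl elements all restrict to the same
  function on \<open>A\<close>.\<close>

lemma trig_invariants_iff:
  assumes A: "open A" "A \<noteq> {}"
  shows "\<phi> \<in> trig_invariants R A S \<longleftrightarrow>
    (\<exists>G. trig_family S G \<and> (\<forall>w\<in>weyl_group R. \<phi> = restrict (G w) A))"
proof
  assume \<phi>: "\<phi> \<in> trig_invariants R A S"
  then obtain T a where T: "finite T" "T \<subseteq> S" "\<phi> = (\<lambda>u\<in>A. \<Sum>\<mu>\<in>T. a \<mu> * trig_exp \<mu> u)"
    by (auto simp: trig_invariants_def trig_def)
  then have "\<phi> = (\<lambda>u\<in>A. \<Sum>\<mu>\<in>T. a \<mu> * trig_exp (w \<mu>) u)" if "w \<in> weyl_group R" for w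
    using trig_act_sum[OF A T(1), of w a] \<phi> that by (simp add: trig_invariants_def)
  with T show "\<exists>G. trig_family S G \<and> (\<forall>w\<in>weyl_group R. \<phi> = restrict (G w) A)"
    unfolding trig_family_def by blast
next
  assume "\<exists>G. trig_family S G \<and> (\<forall>w\<in>weyl_group R. \<phi> = restrict (G w) A)"
  then obtain T a where T: "finite T" "T \<subseteq> S"
    and \<phi>: "\<And>w. w \<in> weyl_group R \<Longrightarrow> \<phi> = (\<lambda>u\<in>A. \<Sum>\<mu>\<in>T. a \<mu> * trig_exp (w \<mu>) u)"
    unfolding trig_family_def by blast
  have id: "\<phi> = (\<lambda>u\<in>A. \<Sum>\<mu>\<in>T. a \<mu> * trig_exp \<mu> u)"
    using \<phi>[OF weyl_group.id] by simp
  then have "trig_act A w \<phi> = \<phi>" if "w \<in> weyl_group R" for w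
    using trig_act_sum[OF A T(1), of w a] \<phi>[OF that] by simp
  with id T show "\<phi> \<in> trig_invariants R A S"
    unfolding trig_invariants_def trig_def by blast
qed

section \<open>The operator on Weyl-invariant trigonometric polynomials\<close>

context chambered_root_system
begin

text \<open>Saturation keeps the whole string in the exponent set; it is applied to
  \<open>\<alpha>\<close> or to \<open>- \<alpha>\<close> according to the sign of
  \<open>\<alpha> \<bullet> \<mu>\<close>.\<close>

lemma trig_family_string:
  assumes \<mu>: "\<mu> \<in> weights_below R C \<nu>" and \<alpha>: "\<alpha> \<in> R"
  shows "trig_family (weights_below R C \<nu>)
    (\<lambda>w u. string_sum \<alpha> \<mu> (\<lambda>\<kappa>. trig_exp (w \<kappa>) u))"
proof -
  define m where "m = nat \<lfloor>\<bar>coroot \<alpha> \<bullet> \<mu>\<bar>\<rfloor>"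
  have in_string: "\<mu> - (real j * sgn (\<alpha> \<bullet> \<mu>)) *\<^sub>R \<alpha> \<in> weights_below R C \<nu>" if j: "j \<le> m" for j
  proof -
    have le: "real j \<le> \<bar>coroot \<alpha> \<bullet> \<mu>\<bar>" using j by (simp add: m_def le_nat_floor le_nat_iff le_floor_iff)
    have sg: "sgn (coroot \<alpha> \<bullet> \<mu>) = sgn (\<alpha> \<bullet> \<mu>)"
      using root_nonzero[OF \<alpha>] by (simp add: coroot_def sgn_mult)
    consider "\<alpha> \<bullet> \<mu> = 0" | "\<alpha> \<bullet> \<mu> > 0" | "\<alpha> \<bullet> \<mu> < 0" by linarith
    then show ?thesis
    proof cases
      case 2
      then have "coroot \<alpha> \<bullet> \<mu> > 0" using sg by (metis sgn_greater)
      then show ?thesis using weights_below_saturated[OF \<mu> \<alpha>, of j] le 2 by simp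
    next
      case 3
      then have "coroot \<alpha> \<bullet> \<mu> < 0" using sg by (metis sgn_less)
      moreover have "coroot (- \<alpha>) \<bullet> \<mu> = - (coroot \<alpha> \<bullet> \<mu>)" by (simp add: coroot_def)
      ultimately show ?thesis
        using weights_below_saturated[OF \<mu> minus_root[OF \<alpha>], of j] le 3 by simp
    qed (use \<mu> in simp)
  qed
  show ?thesis
    unfolding string_sum_def m_def[symmetric]
    by (intro trig_family_sum trig_family_add trig_family_exp in_string) auto
qed

text \<open>Isometries are injective and preserve length, and an injective self-map of a finite set
  is onto.\<close>

lemma weyl_bij_roots_of_norm:
  assumes w: "w \<in> W"
  shows "bij_betw w {\<alpha>\<in>R. norm \<alpha> = c} {\<alpha>\<in>R. norm \<alpha> = c}"
proof -
  have norm: "norm (w x) = norm x" for x using weyl_inner[OF w] by (simp add: norm_eq_sqrt_inner)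
  then have "w x = 0 \<Longrightarrow> x = 0" for x by (metis norm_eq_zero)
  then have "inj w" using weyl_linear[OF w] by (simp add: linear_injective_0)
  then have inj: "inj_on w {\<alpha>\<in>R. norm \<alpha> = c}" using inj_on_subset by blast
  moreover have "w ` {\<alpha>\<in>R. norm \<alpha> = c} \<subseteq> {\<alpha>\<in>R. norm \<alpha> = c}"
    using norm weyl_root[OF w] by auto
  ultimately show ?thesis
    using endo_inj_surj[OF _ _ inj] finite_roots by (simp add: bij_betw_def)
qed

text \<open>A Weyl element need not preserve positivity, so sums over positive roots are doubled to
  sums over all roots before reindexing.\<close>

lemma sum_roots_of_norm:
  fixes h :: "'v \<Rightarrow> complex"
  assumes even: "\<And>\<alpha>. h (- \<alpha>) = h \<alpha>"
  shows "(\<Sum>\<alpha> | \<alpha> \<in> R \<and> norm \<alpha> = c. h \<alpha>) = 2 * (\<Sum>\<alpha> | \<alpha> \<in> R\<^sub>p \<and> norm \<alpha> = c. h \<alpha>)"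
proof -
  let ?Q = "{\<alpha>. \<alpha> \<in> R\<^sub>p \<and> norm \<alpha> = c}"
  have "{\<alpha>. \<alpha> \<in> R \<and> norm \<alpha> = c} = ?Q \<union> uminus ` ?Q"
  proof (intro set_eqI iffI)
    fix \<alpha> assume "\<alpha> \<in> {\<alpha>. \<alpha> \<in> R \<and> norm \<alpha> = c}"
    then have "\<alpha> \<in> ?Q \<or> - \<alpha> \<in> ?Q" using root_cases by auto
    then show "\<alpha> \<in> ?Q \<union> uminus ` ?Q" using image_eqI[of \<alpha> uminus "- \<alpha>" ?Q] by auto
  qed (use pos_root minus_root in auto)
  moreover have "- \<alpha> \<notin> R\<^sub>p" if "\<alpha> \<in> R\<^sub>p" for \<alpha>
    using pos_base[OF that] pos_base[of "- \<alpha>"] by auto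
  then have "?Q \<inter> uminus ` ?Q = {}" by auto
  ultimately have "(\<Sum>\<alpha> | \<alpha> \<in> R \<and> norm \<alpha> = c. h \<alpha>) = sum h ?Q + sum h (uminus ` ?Q)"
    using finite_pos by (simp add: sum.union_disjoint)
  also have "sum h (uminus ` ?Q) = sum h ?Q"
    by (simp add: sum.reindex even)
  finally show ?thesis by simp
qed

text \<open>The expansion of \<open>\<phi>\<close> holds with its exponents moved by any Weyl
  element. Computing the result from the expansion for \<open>w\<close> gives the member at
  \<open>w\<close> of a single family \<open>H\<close>, and \<open>trig_invariants_iff\<close>
  concludes.\<close>

lemma grad_op_sin_product_invariant:
  assumes A: "open A" "A \<noteq> {}"
    and sin: "\<And>\<alpha> u. \<alpha> \<in> R \<Longrightarrow> u \<in> A \<Longrightarrow> sin ((\<alpha> \<bullet> u) / 2) \<noteq> 0"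
    and \<phi>: "\<phi> \<in> trig_invariants R A (weights_below R C \<nu>)"
  shows "grad_op A (\<lambda>u. ln \<bar>sin_product R C c u\<bar>) \<phi> \<in> trig_invariants R A (weights_below R C \<nu>)"
proof -
  let ?S = "weights_below R C \<nu>"
  let ?Q = "{\<alpha>. \<alpha> \<in> R\<^sub>p \<and> norm \<alpha> = c}" and ?P = "{\<alpha>. \<alpha> \<in> R \<and> norm \<alpha> = c}"
  from \<phi> obtain G where "trig_family ?S G" "\<forall>w\<in>W. \<phi> = restrict (G w) A"
    using trig_invariants_iff[OF A] by blast
  then obtain T a where T: "finite T" "T \<subseteq> ?S"
    and rep: "\<And>w. w \<in> W \<Longrightarrow> \<phi> = (\<lambda>u\<in>A. \<Sum>\<mu>\<in>T. a \<mu> * trig_exp (w \<mu>) u)"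
    unfolding trig_family_def by blast
  \<comment> \<open>\<open>D u h\<close> is the derivative of \<open>\<phi>\<close> at
    \<open>u\<close> along \<open>h\<close>; it has one expansion for each Weyl element.\<close>
  define D where "D u h = Complex (h \<bullet> grad (\<lambda>x. Re (\<phi> x)) u) (h \<bullet> grad (\<lambda>x. Im (\<phi> x)) u)" for u h
  have D: "D u h = (\<Sum>\<mu>\<in>T. a \<mu> * (\<i> * of_real (w \<mu> \<bullet> h) * trig_exp (w \<mu>) u))"
    if u: "u \<in> A" and w: "w \<in> W" for u h w
  proof -
    have "((\<lambda>y. \<Sum>\<mu>\<in>T. a \<mu> * trig_exp (w \<mu>) y) has_derivative
        (\<lambda>h. \<Sum>\<mu>\<in>T. a \<mu> * (\<i> * of_real (w \<mu> \<bullet> h) * trig_exp (w \<mu>) u))) (at u)"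
      by (intro has_derivative_sum has_derivative_mult_right has_derivative_trig_exp)
    then have "(\<phi> has_derivative
        (\<lambda>h. \<Sum>\<mu>\<in>T. a \<mu> * (\<i> * of_real (w \<mu> \<bullet> h) * trig_exp (w \<mu>) u))) (at u)"
      by (rule has_derivative_transform_within_open[OF _ A(1) u]) (simp add: rep[OF w])
    from complex_inner_grad[OF this] show ?thesis by (simp add: D_def)
  qed
  have cot_D: "of_real (cot ((\<alpha> \<bullet> u) / 2)) * D u \<alpha> = - (\<Sum>\<mu>\<in>T. a \<mu> *
      (of_real \<bar>\<alpha> \<bullet> w \<mu>\<bar> * string_sum \<alpha> (w \<mu>) (\<lambda>\<kappa>. trig_exp \<kappa> u))) / 2"
    if u: "u \<in> A" and w: "w \<in> W" and \<alpha>: "\<alpha> \<in> R" for u w \<alpha>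
  proof -
    have w': "reflection \<alpha> \<circ> w \<in> W" using weyl_group.reflection[OF w \<alpha>] .
    have refl: "\<alpha> \<bullet> reflection \<alpha> x = - (\<alpha> \<bullet> x)" for x
      by (simp add: reflection_self root_nonzero[OF \<alpha>] flip: inner_reflection_swap)
    have int: "coroot \<alpha> \<bullet> w \<mu> \<in> \<int>" if "\<mu> \<in> T" for \<mu>
      using that T(2) weyl_weight[OF w] \<alpha> by (auto simp: mem_weights_below_iff weight_lattice_def)
    \<comment> \<open>One copy is expanded by \<open>w\<close>, the other by
      \<open>reflection \<alpha> \<circ> w\<close>. The reflection reverses the pairing with
      \<open>\<alpha>\<close>, so differences of exponentials appear.\<close>
    have "2 * D u \<alpha> = D u \<alpha> + D u \<alpha>" by simp
    also have "\<dots> = (\<Sum>\<mu>\<in>T. a \<mu> * (\<i> * of_real (w \<mu> \<bullet> \<alpha>) * trig_exp (w \<mu>) u)) +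
        (\<Sum>\<mu>\<in>T. a \<mu> * (\<i> * of_real ((reflection \<alpha> \<circ> w) \<mu> \<bullet> \<alpha>) * trig_exp ((reflection \<alpha> \<circ> w) \<mu>) u))"
      using D[OF u w] D[OF u w'] by simp
    also have "\<dots> = (\<Sum>\<mu>\<in>T. \<i> * a \<mu> * (of_real (\<alpha> \<bullet> w \<mu>) *
        (trig_exp (w \<mu>) u - trig_exp (reflection \<alpha> (w \<mu>)) u)))"
      unfolding sum.distrib[symmetric]
      by (rule sum.cong) (simp_all add: refl inner_commute algebra_simps)
    finally have two: "2 * D u \<alpha> = (\<Sum>\<mu>\<in>T. \<i> * a \<mu> * (of_real (\<alpha> \<bullet> w \<mu>) *
        (trig_exp (w \<mu>) u - trig_exp (reflection \<alpha> (w \<mu>)) u)))" .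
    have "2 * (of_real (cot ((\<alpha> \<bullet> u) / 2)) * D u \<alpha>) = of_real (cot ((\<alpha> \<bullet> u) / 2)) * (2 * D u \<alpha>)"
      by simp
    also have "\<dots> = (\<Sum>\<mu>\<in>T. \<i> * a \<mu> *
        (of_real (cot ((\<alpha> \<bullet> u) / 2) * (\<alpha> \<bullet> w \<mu>)) *
          (trig_exp (w \<mu>) u - trig_exp (reflection \<alpha> (w \<mu>)) u)))"
      unfolding two by (simp add: sum_distrib_left mult_ac)
    also have "\<dots> = - (\<Sum>\<mu>\<in>T. a \<mu> *
        (of_real \<bar>\<alpha> \<bullet> w \<mu>\<bar> * string_sum \<alpha> (w \<mu>) (\<lambda>\<kappa>. trig_exp \<kappa> u)))"
      unfolding sum_negf[symmetric]
      by (rule sum.cong, simp, simp only: cot_string[OF sin[OF \<alpha> u] int])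
        (simp add: algebra_simps)
    finally show ?thesis
      by (simp only: eq_divide_eq_numeral1 mult.commute[of _ 2]) simp
  qed
  \<comment> \<open>The factor combines \<open>-1/2\<close> from \<open>cot_D\<close>,
    \<open>1/2\<close> from the half angle and \<open>1/2\<close> from passing to all roots. Here
    \<open>w\<close> occurs only in the exponents.\<close>
  define H where "H w u = (-1/8) * (\<Sum>\<alpha>\<in>?P. \<Sum>\<mu>\<in>T. a \<mu> *
      (of_real \<bar>\<alpha> \<bullet> \<mu>\<bar> * string_sum \<alpha> \<mu> (\<lambda>\<kappa>. trig_exp (w \<kappa>) u)))"
    for w :: "'v \<Rightarrow> 'v" and u :: 'v
  have "trig_family ?S H"
    unfolding H_def[abs_def] using T(2)
    by (intro trig_family_cmult trig_family_sum trig_family_string) auto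
  moreover have "grad_op A (\<lambda>u. ln \<bar>sin_product R C c u\<bar>) \<phi> = restrict (H w) A" if w: "w \<in> W" for w
    unfolding grad_op_def D_def[symmetric]
  proof (rule restrict_ext)
    fix u assume u: "u \<in> A"
    define g where "g = grad (\<lambda>u. ln \<bar>sin_product R C c u\<bar>) u"
    have Q: "finite ?Q" "\<And>\<alpha>. \<alpha> \<in> ?Q \<Longrightarrow> sin ((\<alpha> \<bullet> u) / 2) \<noteq> 0"
      using finite_pos sin[OF pos_root u] by auto
    have "((\<lambda>x. ln \<bar>sin_product R C c x\<bar>) has_derivative
        (\<lambda>h. \<Sum>\<alpha>\<in>?Q. cot ((\<alpha> \<bullet> u) / 2) / 2 * (\<alpha> \<bullet> h))) (at u)"
      unfolding sin_product_def
      by (rule has_derivative_ln_abs[OF has_derivative_sin_prod]) (use Q in auto)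
    from inner_grad[OF this]
    have "h \<bullet> g = (\<Sum>\<alpha>\<in>?Q. (cot ((\<alpha> \<bullet> u) / 2) / 2) * (\<alpha> \<bullet> h))" for h
      by (simp add: g_def)
    then have "D u g = (\<Sum>\<alpha>\<in>?Q. of_real (cot ((\<alpha> \<bullet> u) / 2) / 2) * D u \<alpha>)"
      by (simp add: D_def inner_commute[of g] complex_eq_iff)
    also have "\<dots> = (\<Sum>\<alpha>\<in>?Q. of_real (cot ((\<alpha> \<bullet> u) / 2)) * D u \<alpha>) / 2"
      by (simp add: sum_divide_distrib)
    also have "\<dots> = (\<Sum>\<alpha>\<in>?P. of_real (cot ((\<alpha> \<bullet> u) / 2)) * D u \<alpha>) / 4"
    proof -
      have "of_real (cot ((- \<alpha> \<bullet> u) / 2)) * D u (- \<alpha>) = of_real (cot ((\<alpha> \<bullet> u) / 2)) * D u \<alpha>" for \<alpha>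
        by (simp add: D_def cot_def complex_eq_iff)
      from sum_roots_of_norm[of "\<lambda>\<alpha>. of_real (cot ((\<alpha> \<bullet> u) / 2)) * D u \<alpha>", OF this]
      show ?thesis by simp
    qed
    \<comment> \<open>Reindexing by \<open>w\<close> moves the root along with the weights, so that
      \<open>string_sum_isometry\<close> applies.\<close>
    also have "(\<Sum>\<alpha>\<in>?P. of_real (cot ((\<alpha> \<bullet> u) / 2)) * D u \<alpha>) =
        (\<Sum>\<alpha>\<in>?P. of_real (cot ((w \<alpha> \<bullet> u) / 2)) * D u (w \<alpha>))"
      by (rule sum.reindex_bij_betw[OF weyl_bij_roots_of_norm[OF w], symmetric])
    also have "\<dots> = (\<Sum>\<alpha>\<in>?P. - (\<Sum>\<mu>\<in>T. a \<mu> *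
        (of_real \<bar>\<alpha> \<bullet> \<mu>\<bar> * string_sum \<alpha> \<mu> (\<lambda>\<kappa>. trig_exp (w \<kappa>) u))) / 2)"
    proof (rule sum.cong)
      fix \<alpha> assume "\<alpha> \<in> ?P"
      then have "w \<alpha> \<in> R" using weyl_root[OF w] by simp
      from cot_D[OF u w this]
      show "of_real (cot ((w \<alpha> \<bullet> u) / 2)) * D u (w \<alpha>) = - (\<Sum>\<mu>\<in>T. a \<mu> *
          (of_real \<bar>\<alpha> \<bullet> \<mu>\<bar> * string_sum \<alpha> \<mu> (\<lambda>\<kappa>. trig_exp (w \<kappa>) u))) / 2"
        by (simp only: string_sum_isometry[OF weyl_linear[OF w] weyl_inner[OF w]] weyl_inner[OF w])
    qed simp
    also have "\<dots> / 4 = H w u"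
      by (simp add: H_def sum_negf flip: sum_divide_distrib)
    finally show "D u (grad (\<lambda>u. ln \<bar>sin_product R C c u\<bar>) u) = H w u"
      by (simp only: g_def)
  qed
  ultimately show ?thesis using trig_invariants_iff[OF A] by blast
qed

end

text \<open>Identifies the walls of the alcove with the zeros of the sine factors.\<close>

lemma sin_half_eq_zero_iff: "sin (x / 2) = 0 \<longleftrightarrow> (\<exists>k::int. x = 2 * pi * of_int k)"
  by (auto simp: sin_zero_iff_int2 field_simps)

theorem proposition12:
  fixes R C A :: "'v::euclidean_space set" and c :: real and \<nu> :: 'v
  assumes "irreducible_root_system R"
    and "weyl_chamber R C"
    and "fundamental_alcove R C A"
    and "root_length R c"
    and "\<nu> \<in> dominant_weights R C"
  shows "\<forall>\<phi> \<in> trig_invariants R A (weights_below R C \<nu>).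
           grad_op A (\<lambda>u. ln \<bar>sin_product R C c u\<bar>) \<phi> \<in> trig_invariants R A (weights_below R C \<nu>)"
proof -
  interpret chambered_root_system R C
    using assms by unfold_locales (simp_all add: irreducible_root_system_def)
  let ?H = "\<lambda>\<alpha>. {u. \<exists>k::int. \<alpha> \<bullet> u = 2 * pi * of_int k}"
  have A: "A \<in> components (UNIV - (\<Union>\<alpha>\<in>R. ?H \<alpha>))"
    using assms by (simp add: fundamental_alcove_def)
  \<comment> \<open>As the zero set of a continuous function it is closed. With finitely many roots
    the complement is open, and so is its component \<open>A\<close>, as uniqueness of coefficients
    requires.\<close>
  have "closed (?H \<alpha>)" for \<alpha>
  proof -
    have "?H \<alpha> = {u. sin ((\<alpha> \<bullet> u) / 2) = 0}" by (simp add: sin_half_eq_zero_iff)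
    then show ?thesis by (simp add: closed_Collect_eq continuous_intros)
  qed
  then have "open (UNIV - (\<Union>\<alpha>\<in>R. ?H \<alpha>))"
    using finite_roots by (intro open_Diff open_UNIV closed_UN) auto
  then have "open A" using A open_components by blast
  moreover have "A \<noteq> {}" using A in_components_nonempty by blast
  moreover have "sin ((\<alpha> \<bullet> u) / 2) \<noteq> 0" if "\<alpha> \<in> R" "u \<in> A" for \<alpha> u
    using in_components_subset[OF A] that by (auto simp: sin_half_eq_zero_iff)
  ultimately show ?thesis using grad_op_sin_product_invariant by blast
qed

end
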